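(* (Generalized Marini formulas.) Consider the discrete primal functional $$I_h^{cr}(v_h):=\int_\Omega\phi(\nabla_hv_h)\,\mathrm{d}x+\int_\Omega\psi_h(\cdot,\Pi_hv_h)\,\mathrm{d}x,\qquad v_h\in\mathcal{S}^{1,cr}_D(\mathcal{T}_h),$$ which is to be minimized, and the discrete dual functional $$D_h^{rt}(y_h):=-\int_\Omega\phi^*(\Pi_hy_h)\,\mathrm{d}x-\int_\Omega\psi_h^*(\cdot,\mathrm{div}\,y_h)\,\mathrm{d}x,\qquad y_h\in\mathcal{R}T^0_N(\mathcal{T}_h),$$ which is to be maximized. The following statements apply: (i) If $\phi\in C^1(\mathbb{R}^d)$ and $\psi_h(x,\cdot)\in C^1(\mathbb{R})$ for a.e. $x\in\Omega$, then, given a minimizer $u_h^{cr}\in\mathcal{S}^{1,cr}_D(\mathcal{T}_h)$ of $I_h^{cr}$, a maximizer $z_h^{rt}\in\mathcal{R}T^0_N(\mathcal{T}_h)$ of $D_h^{rt}$ is given via $$z_h^{rt}=D\phi(\nabla_hu_h^{cr})+\frac{D\psi_h(\cdot,\Pi_hu_h^{cr})}{d}\big(\mathrm{id}_{\mathbb{R}^d}-\Pi_h\mathrm{id}_{\mathbb{R}^d}\big)\quad\text{in }\mathcal{R}T^0_N(\mathcal{T}_h)$$ (in particular, the right-hand side belongs to $\mathcal{R}T^0_N(\mathcal{T}_h)$), and a discrete strong duality relation applies, i.e., $I_h^{cr}(u_h^{cr})=D_h^{rt}(z_h^{rt})$. (ii) If $\phi^*\in C^1(\mathbb{R}^d)$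 and $\psi_h^*(x,\cdot)\in C^1(\mathbb{R})$ for a.e. $x\in\Omega$, then, given a maximizer $z_h^{rt}\in\mathcal{R}T^0_N(\mathcal{T}_h)$ of $D_h^{rt}$, a minimizer $u_h^{cr}\in\mathcal{S}^{1,cr}_D(\mathcal{T}_h)$ of $I_h^{cr}$ is given via $$u_h^{cr}=D\psi_h^*(\cdot,\mathrm{div}\,z_h^{rt})+D\phi^*(\Pi_hz_h^{rt})\cdot\big(\mathrm{id}_{\mathbb{R}^d}-\Pi_h\mathrm{id}_{\mathbb{R}^d}\big)\quad\text{in }\mathcal{S}^{1,cr}_D(\mathcal{T}_h)$$ (in particular, the right-hand side belongs to $\mathcal{S}^{1,cr}_D(\mathcal{T}_h)$), and a discrete strong duality relation applies, i.e., $I_h^{cr}(u_h^{cr})=D_h^{rt}(z_h^{rt})$.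
   Context: Let $\Omega\subseteq\mathbb{R}^d$, $d\in\mathbb{N}$, be a bounded polyhedral Lipschitz domain whose boundary is the disjoint union of a closed Dirichlet part $\Gamma_D$ and an open Neumann part $\Gamma_N$. Let $\mathcal{T}_h$ be a member of a family of uniformly shape regular, conforming simplicial triangulations of $\Omega$, such that each boundary side belongs to $\Gamma_D$ or to the closure of $\Gamma_N$. Let $\mathcal{S}_h$ and $\mathcal{S}_h^i$ be the sets of sides and interior sides of the elements, and $x_S$ the barycenter of a side $S$. For $k\ge0$, $\mathcal{L}^k(\mathcal{T}_h)$ denotes the space of element-wise polynomial functions of degree at most $k$ (no continuity required). $\Pi_h$ is the (local) $L^2$-projection onto element-wise constant functions or vector fields, $\Pi_hv|_T=\frac1{|T|}\int_Tv\,\mathrm{d}x$ for all $T\in\mathcal{T}_h$; $\nabla_h$ is the element-wise gradient; $\mathrm{id}_{\mathbb{R}^d}$ is the identity map $x\mapsto x$. Crouzeix–Raviart space: $\mathcal{S}^{1,cr}(\mathcal{T}_h)$ is the set of $v_h\in\mathcal{L}^1(\mathcal{T}_h)$ that are continuous at $x_S$ for every $S\in\mathcal{S}_h^i$; $\mathcal{S}^{1,cr}_D(\mathcal{T}_h)$ is the subset of those with $v_h(x_S)=0$ for all sides $S\subseteq\Gamma_D$. Raviart–Thomas space: $\mathcal{R}T^0(\mathcal{T}_h)$ is the set of $y_h\in\mathcal{L}^1(\mathcal{T}_h)^d$ whose normal component is constant on each side of each element and continuous across interior sides; $\mathcal{R}T^0_N(\mathcal{T}_h)$ is the subset of those with $y_h\cdot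 n=0$ on $\Gamma_N$, where $n$ is the outward unit normal to $\Omega$. The function $\phi:\mathbb{R}^d\to\mathbb{R}\cup\{+\infty\}$ is proper, convex and lower semi-continuous. The function $\psi_h:\Omega\times\mathbb{R}\to\mathbb{R}\cup\{+\infty\}$ (in applications an approximation of a given measurable $\psi:\Omega\times\mathbb{R}\to\mathbb{R}\cup\{+\infty\}$ that is proper, convex and lower semi-continuous in its second argument) is such that $\psi_h(\cdot,t)\in\mathcal{L}^0(\mathcal{T}_h)$ for all $t\in\mathbb{R}$, and $\psi_h(x,\cdot)$ is proper, convex and lower semi-continuous for a.e. $x\in\Omega$. $\phi^*$ is the Fenchel conjugate of $\phi$, and $\psi_h^*$ is the Fenchel conjugate of $\psi_h$ with respect to the second argument. $D\phi$, $D\phi^*$ are the gradients of $\phi$, $\phi^*$, and $D\psi_h$, $D\psi_h^*$ the derivatives of $\psi_h$, $\psi_h^*$ with respect to the second argument. Standing assumption: $\phi$ and $\psi_h$ are such that $I_h^{cr}$ (the functional defined in the claim) admits at least one minimizer in $\mathcal{S}^{1,cr}_D(\mathcal{T}_h)$, $D_h^{rt}$ admits at least one maximizer in $\mathcal{R}T^0_N(\mathcal{T}_h)$, and the minimal value of $I_h^{cr}$ equals the maximal value of $D_h^{rt}$. *)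

theory Defs
  imports "HOL-Analysis.Analysis"
begin

section \<open>Extended-real-valued convex functions\<close>

definition proper_fun :: "('a \<Rightarrow> ereal) \<Rightarrow> bool" where
  "proper_fun f \<longleftrightarrow> (\<forall>x. f x \<noteq> -\<infinity>) \<and> (\<exists>x. f x \<noteq> \<infinity>)"

text \<open>The weights are taken in the open unit interval because \<open>0 * \<infinity> = 0\<close> in \<^typ>\<open>ereal\<close>.\<close>

definition convex_fun :: "('a::real_vector \<Rightarrow> ereal) \<Rightarrow> bool" where
  "convex_fun f \<longleftrightarrow>
     (\<forall>x y. \<forall>l\<in>{0<..<1}. f ((1 - l) *\<^sub>R x + l *\<^sub>R y) \<le> ereal (1 - l) * f x + ereal l * f y)"

definition lsc_fun :: "('a::topological_space \<Rightarrow> ereal) \<Rightarrow> bool" where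
  "lsc_fun f \<longleftrightarrow> (\<forall>x. f x \<le> Liminf (at x) f)"

definition fenchel_conj :: "('a::real_inner \<Rightarrow> ereal) \<Rightarrow> 'a \<Rightarrow> ereal" where
  "fenchel_conj f s = (SUP t. ereal (s \<bullet> t) - f t)"

definition gradient :: "('a::real_inner \<Rightarrow> real) \<Rightarrow> 'a \<Rightarrow> 'a" where
  "gradient f x = (THE D. GDERIV f x :> D)"

text \<open>For \<open>'a = real\<close> the gradient is the ordinary derivative (see \<open>gderiv_deriv\<close>), so the
  next two definitions serve both the functions on $R^d$ and those on $R$.\<close>

definition D_ext :: "('a::real_inner \<Rightarrow> ereal) \<Rightarrow> 'a \<Rightarrow> 'a" where
  "D_ext f = gradient (\<lambda>x. real_of_ereal (f x))"

definition C1_ext :: "('a::real_inner \<Rightarrow> ereal) \<Rightarrow> bool" where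
  "C1_ext f \<longleftrightarrow>
     (\<forall>x. \<bar>f x\<bar> \<noteq> \<infinity>) \<and>
     (\<forall>x. GDERIV (\<lambda>x. real_of_ereal (f x)) x :> D_ext f x) \<and>
     continuous_on UNIV (D_ext f)"

text \<open>Integral of positive part minus integral of negative part (\<^const>\<open>e2ennreal\<close> maps
  negative numbers to 0). It is meaningful unless both are infinite.\<close>

definition ext_integral :: "'a::euclidean_space set \<Rightarrow> ('a \<Rightarrow> ereal) \<Rightarrow> ereal" where
  "ext_integral A f =
     enn2ereal (\<integral>\<^sup>+x\<in>A. e2ennreal (f x) \<partial>lebesgue) - enn2ereal (\<integral>\<^sup>+x\<in>A. e2ennreal (- f x) \<partial>lebesgue)"


section \<open>Domains and triangulations\<close>

text \<open>Near each boundary point, and after choosing a vertical direction \<open>e\<close>, the set is the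
  strict subgraph of a Lipschitz function \<open>g\<close> of the component orthogonal to \<open>e\<close>.\<close>

definition Lipschitz_boundary :: "'a::euclidean_space set \<Rightarrow> bool" where
  "Lipschitz_boundary \<Omega> \<longleftrightarrow>
     (\<forall>x\<in>frontier \<Omega>. \<exists>r>0. \<exists>e g L. norm e = 1 \<and> L-lipschitz_on {w. w \<bullet> e = 0} g \<and>
        \<Omega> \<inter> ball x r = {y \<in> ball x r. y \<bullet> e < g (y - (y \<bullet> e) *\<^sub>R e)})"

definition polyhedral_Lipschitz_domain :: "'a::euclidean_space set \<Rightarrow> bool" where
  "polyhedral_Lipschitz_domain \<Omega> \<longleftrightarrow>
     open \<Omega> \<and> connected \<Omega> \<and> \<Omega> \<noteq> {} \<and> bounded \<Omega> \<and>
     (\<exists>\<P>. finite \<P> \<and> (\<forall>P\<in>\<P>. polytope P) \<and> closure \<Omega> = \<Union>\<P>) \<and>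
     Lipschitz_boundary \<Omega>"

text \<open>Elements are closed simplices of full dimension; conformity (the intersection of two elements
  is a common, possibly empty, face) is part of the library's \<^const>\<open>triangulation\<close>.\<close>

definition conforming_triangulation :: "'a::euclidean_space set \<Rightarrow> 'a set set \<Rightarrow> bool" where
  "conforming_triangulation \<Omega> \<T> \<longleftrightarrow>
     triangulation \<T> \<and> (\<forall>T\<in>\<T>. int DIM('a) simplex T) \<and> \<Union>\<T> = closure \<Omega>"

definition inradius :: "'a::euclidean_space set \<Rightarrow> real" where
  "inradius T = Sup {r. r > 0 \<and> (\<exists>x. ball x r \<subseteq> T)}"

definition uniformly_shape_regular :: "'a::euclidean_space set set set \<Rightarrow> bool" where
  "uniformly_shape_regular \<F> \<longleftrightarrow> (\<exists>\<kappa>>0. \<forall>\<T>\<in>\<F>. \<forall>T\<in>\<T>. diameter T \<le> \<kappa> * inradius T)"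

definition sides :: "'a::euclidean_space set set \<Rightarrow> 'a set set" where
  "sides \<T> = {S. \<exists>T\<in>\<T>. S facet_of T}"

definition boundary_sides :: "'a::euclidean_space set \<Rightarrow> 'a set set \<Rightarrow> 'a set set" where
  "boundary_sides \<Omega> \<T> = {S \<in> sides \<T>. S \<subseteq> frontier \<Omega>}"

definition interior_sides :: "'a::euclidean_space set \<Rightarrow> 'a set set \<Rightarrow> 'a set set" where
  "interior_sides \<Omega> \<T> = sides \<T> - boundary_sides \<Omega> \<T>"

definition boundary_partition :: "'a::euclidean_space set \<Rightarrow> 'a set \<Rightarrow> 'a set \<Rightarrow> bool" where
  "boundary_partition \<Omega> \<Gamma>\<^sub>D \<Gamma>\<^sub>N \<longleftrightarrow>
     \<Gamma>\<^sub>D \<union> \<Gamma>\<^sub>N = frontier \<Omega> \<and> \<Gamma>\<^sub>D \<inter> \<Gamma>\<^sub>N = {} \<and>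
     closed \<Gamma>\<^sub>D \<and> openin (top_of_set (frontier \<Omega>)) \<Gamma>\<^sub>N"

definition boundary_fitted :: "'a::euclidean_space set \<Rightarrow> 'a set \<Rightarrow> 'a set \<Rightarrow> 'a set set \<Rightarrow> bool" where
  "boundary_fitted \<Omega> \<Gamma>\<^sub>D \<Gamma>\<^sub>N \<T> \<longleftrightarrow>
     (\<forall>S\<in>boundary_sides \<Omega> \<T>. S \<subseteq> \<Gamma>\<^sub>D \<or> S \<subseteq> closure \<Gamma>\<^sub>N)"

definition barycenter :: "'a::euclidean_space set \<Rightarrow> 'a" where
  "barycenter S = (let V = {v. v extreme_point_of S} in (1 / card V) *\<^sub>R \<Sum>V)"

text \<open>\<open>n\<close> is the unit normal on the side \<open>S\<close> of \<open>T\<close> pointing out of \<open>T\<close>; when \<open>S\<close> lies in the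
  boundary of the domain, it is the outward unit normal to the domain on \<open>S\<close>.\<close>

definition outward_unit_normal :: "'a::euclidean_space set \<Rightarrow> 'a set \<Rightarrow> 'a \<Rightarrow> bool" where
  "outward_unit_normal T S n \<longleftrightarrow>
     norm n = 1 \<and> (\<exists>c. T \<subseteq> {x. n \<bullet> x \<le> c} \<and> S = T \<inter> {x. n \<bullet> x = c})"


section \<open>Element-wise functions and operators\<close>

text \<open>Element-wise functions are represented by functions on the whole space of which only the
  values in the interiors of the elements matter; their values on the sides, a null set, are
  arbitrary. The value at a point of a side, seen from the element \<open>T\<close>, is the limit from
  inside \<open>T\<close>.\<close>

definition elem_trace :: "'a::euclidean_space set \<Rightarrow> ('a \<Rightarrow> 'b::t2_space) \<Rightarrow> 'a \<Rightarrow> 'b" where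
  "elem_trace T v x = Lim (at x within interior T) v"

definition polynomial_le :: "nat \<Rightarrow> (real^'n \<Rightarrow> 'b::real_vector) \<Rightarrow> bool" where
  "polynomial_le k p \<longleftrightarrow>
     (\<exists>c :: ('n \<Rightarrow> nat) \<Rightarrow> 'b. \<forall>x. p x = (\<Sum>\<alpha> | sum \<alpha> UNIV \<le> k. (\<Prod>i\<in>UNIV. (x $ i) ^ \<alpha> i) *\<^sub>R c \<alpha>))"

definition L_space :: "nat \<Rightarrow> (real^'n) set set \<Rightarrow> (real^'n \<Rightarrow> 'b::real_vector) set" where
  "L_space k \<T> = {v. \<forall>T\<in>\<T>. \<exists>p. polynomial_le k p \<and> (\<forall>x\<in>interior T. v x = p x)}"

text \<open>The counterpart of degree 0 for functions that may take the value \<open>\<infinity>\<close>.\<close>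

definition elementwise_const :: "'a::euclidean_space set set \<Rightarrow> ('a \<Rightarrow> 'b) \<Rightarrow> bool" where
  "elementwise_const \<T> f \<longleftrightarrow> (\<forall>T\<in>\<T>. \<exists>c. \<forall>x\<in>interior T. f x = c)"

text \<open>The interiors of the elements are disjoint, so at most one summand is nonzero in the following
  three definitions.\<close>

definition proj0 :: "'a::euclidean_space set set \<Rightarrow> ('a \<Rightarrow> 'b::euclidean_space) \<Rightarrow> 'a \<Rightarrow> 'b" where
  "proj0 \<T> v x =
     (\<Sum>T\<in>\<T>. indicat_real (interior T) x *\<^sub>R ((1 / measure lebesgue T) *\<^sub>R (LINT y:T|lebesgue. v y)))"

definition grad_h :: "'a::euclidean_space set set \<Rightarrow> ('a \<Rightarrow> real) \<Rightarrow> 'a \<Rightarrow> 'a" where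
  "grad_h \<T> v x = (\<Sum>T\<in>\<T>. indicat_real (interior T) x *\<^sub>R gradient v x)"

definition div_h :: "'a::euclidean_space set set \<Rightarrow> ('a \<Rightarrow> 'a) \<Rightarrow> 'a \<Rightarrow> real" where
  "div_h \<T> y x =
     (\<Sum>T\<in>\<T>. indicat_real (interior T) x * (\<Sum>b\<in>Basis. frechet_derivative y (at x) b \<bullet> b))"


section \<open>Crouzeix--Raviart and Raviart--Thomas spaces\<close>

definition CR :: "(real^'n) set \<Rightarrow> (real^'n) set set \<Rightarrow> (real^'n \<Rightarrow> real) set" where
  "CR \<Omega> \<T> = {v \<in> L_space 1 \<T>. \<forall>S\<in>interior_sides \<Omega> \<T>. \<forall>T\<in>\<T>. \<forall>T'\<in>\<T>.
     S facet_of T \<and> S facet_of T' \<longrightarrow>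
       elem_trace T v (barycenter S) = elem_trace T' v (barycenter S)}"

definition CR_D :: "(real^'n) set \<Rightarrow> (real^'n) set \<Rightarrow> (real^'n) set set \<Rightarrow> (real^'n \<Rightarrow> real) set" where
  "CR_D \<Omega> \<Gamma>\<^sub>D \<T> = {v \<in> CR \<Omega> \<T>. \<forall>S\<in>sides \<T>. S \<subseteq> \<Gamma>\<^sub>D \<longrightarrow>
     (\<forall>T\<in>\<T>. S facet_of T \<longrightarrow> elem_trace T v (barycenter S) = 0)}"

definition RT :: "(real^'n) set \<Rightarrow> (real^'n) set set \<Rightarrow> (real^'n \<Rightarrow> real^'n) set" where
  "RT \<Omega> \<T> = {y \<in> L_space 1 \<T>.
     (\<forall>T\<in>\<T>. \<forall>S n. S facet_of T \<and> outward_unit_normal T S n \<longrightarrow>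
        (\<exists>c. \<forall>x\<in>S. elem_trace T y x \<bullet> n = c)) \<and>
     (\<forall>S\<in>interior_sides \<Omega> \<T>. \<forall>T\<in>\<T>. \<forall>T'\<in>\<T>. \<forall>n.
        S facet_of T \<and> S facet_of T' \<and> outward_unit_normal T S n \<longrightarrow>
        (\<forall>x\<in>S. elem_trace T y x \<bullet> n = elem_trace T' y x \<bullet> n))}"

definition RT_N :: "(real^'n) set \<Rightarrow> (real^'n) set \<Rightarrow> (real^'n) set set \<Rightarrow> (real^'n \<Rightarrow> real^'n) set" where
  "RT_N \<Omega> \<Gamma>\<^sub>N \<T> = {y \<in> RT \<Omega> \<T>. \<forall>S\<in>boundary_sides \<Omega> \<T>. \<forall>T\<in>\<T>. \<forall>n.
     S facet_of T \<and> outward_unit_normal T S n \<longrightarrow> (\<forall>x\<in>S \<inter> \<Gamma>\<^sub>N. elem_trace T y x \<bullet> n = 0)}"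


section \<open>Discrete primal and dual functionals\<close>

definition I_cr :: "(real^'n) set \<Rightarrow> (real^'n) set set \<Rightarrow> (real^'n \<Rightarrow> ereal) \<Rightarrow>
    (real^'n \<Rightarrow> real \<Rightarrow> ereal) \<Rightarrow> (real^'n \<Rightarrow> real) \<Rightarrow> ereal" where
  "I_cr \<Omega> \<T> \<phi> \<psi> v =
     ext_integral \<Omega> (\<lambda>x. \<phi> (grad_h \<T> v x)) + ext_integral \<Omega> (\<lambda>x. \<psi> x (proj0 \<T> v x))"

definition D_rt :: "(real^'n) set \<Rightarrow> (real^'n) set set \<Rightarrow> (real^'n \<Rightarrow> ereal) \<Rightarrow>
    (real^'n \<Rightarrow> real \<Rightarrow> ereal) \<Rightarrow> (real^'n \<Rightarrow> real^'n) \<Rightarrow> ereal" where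
  "D_rt \<Omega> \<T> \<phi> \<psi> y =
     - ext_integral \<Omega> (\<lambda>x. fenchel_conj \<phi> (proj0 \<T> y x))
     - ext_integral \<Omega> (\<lambda>x. fenchel_conj (\<psi> x) (div_h \<T> y x))"

end

theory Submission
  imports Defs
begin

text \<open>A primal minimizer and a dual maximizer have equal values. By discrete
  integration by parts, \<open>\<integral> \<nabla>\<^sub>h v \<bullet> \<Pi>\<^sub>h y + \<integral> \<Pi>\<^sub>h v div y = 0\<close>, the duality gap is a sum of nonnegative
  Fenchel--Young gaps, one for \<open>\<phi>\<close> and one for \<open>\<psi>\<close> on each element, so all of them vanish. On every
  element, differentiability then turns \<open>\<Pi>\<^sub>h z\<close> and \<open>div z\<close> into derivatives at \<open>\<nabla>\<^sub>h u\<close> and \<open>\<Pi>\<^sub>h u\<close>, or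
  conversely. A Raviart--Thomas field has the form \<open>\<Pi>\<^sub>h z + (div z / d) (id - \<Pi>\<^sub>h id)\<close> on each
  element, and a Crouzeix--Raviart function the form \<open>\<Pi>\<^sub>h u + \<nabla>\<^sub>h u \<bullet> (id - \<Pi>\<^sub>h id)\<close>, so the given
  formula reproduces an optimizer whose existence is assumed; no density or basis argument is needed.\<close>

text \<open>Integration by parts is done without surface measure. On one element it is an identity
  between values at the barycenters of the sides, with \<open>bary_grad\<close> in the role of the
  normal; what remains is that the contributions of two elements meeting at a side cancel. This
  compares their volumes, and since the affine map between them moves a single vertex, determinants
  of rank-one updates of the identity suffice. A map of the same kind, exchanging two vertices,
  gives the means of the barycentric coordinates. The other input is combinatorial: a side not
  contained in the boundary belongs to exactly two elements, which lie on opposite sides of it. Two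
  features of the setting need care. Element-wise functions matter only inside the elements, so a
  reconstructed function agrees with an optimizer there and not necessarily elsewhere. Integrals may
  be infinite, but a common value of the primal and the dual functional forces all four of them to
  be finite. The Lipschitz boundary rules out slits, so every element interior lies in \<Omega>, and
  properties of \<open>\<psi>\<close> assumed almost everywhere in \<Omega> hold on every
  element.\<close>

section \<open>Rank-one maps and Lebesgue measure\<close>

text \<open>The matrix \<open>M\<close> below is the identity with row \<open>k\<close> replaced by \<open>\<nu>\<close>; conjugating with it
  reduces the claim to Cramer's rule for a single changed column.\<close>

lemma det_rank_one_update:
  fixes w \<nu> :: "real^'n"
  shows "det (matrix (\<lambda>x. x + (\<nu> \<bullet> x) *\<^sub>R w)) = 1 + \<nu> \<bullet> w"
proof (cases "\<nu> = 0")
  case True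
  then show ?thesis by (simp add: matrix_id[unfolded id_def])
next
  case False
  then obtain k where k: "\<nu> $ k \<noteq> 0"
    by (auto simp: vec_eq_iff)
  define M :: "real^'n^'n" where "M = (\<chi> i. if i = k then \<nu> else axis i 1)"
  define B :: "real^'n^'n" where "B = (\<chi> i j. if j = k then (axis k 1 + M *v w) $ i else mat 1 $ i $ j)"
  have Mv: "(M *v x) $ i = (if i = k then \<nu> \<bullet> x else x $ i)" for x i
    by (simp add: M_def matrix_vector_mul_component inner_axis')
  have detM: "det M = \<nu> $ k"
  proof -
    have "M = (\<chi> i. if i = k then \<Sum>j\<in>UNIV. (\<nu> $ j) *s row j (mat 1) else row i (mat 1))"
      by (auto simp: M_def vec_eq_iff row_def mat_def axis_def if_distrib cong: if_cong)
    then show ?thesis by (simp only: cramer_lemma_transpose) simp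
  qed
  have detB: "det B = 1 + \<nu> \<bullet> w"
  proof -
    have "B = (\<chi> i j. if j = k then (mat 1 *v (axis k 1 + M *v w)) $ i else mat 1 $ i $ j)"
      by (simp add: B_def cong: if_cong)
    then have "det B = (axis k 1 + M *v w) $ k * det (mat 1 :: real^'n^'n)"
      by (simp only: cramer_lemma)
    then show ?thesis by (simp add: Mv)
  qed
  let ?f = "\<lambda>x. x + (\<nu> \<bullet> x) *\<^sub>R w"
  have lin: "linear ?f"
    by (rule linearI) (simp_all add: inner_add_right scaleR_add_left algebra_simps)
  have Bv: "B *v y = y + (y $ k) *\<^sub>R (M *v w)" for y
  proof -
    have "(B *v y) $ i = (y + (y $ k) *\<^sub>R (M *v w)) $ i" for i
    proof -
      have "(B *v y) $ i = (\<Sum>j\<in>UNIV. mat 1 $ i $ j * y $ j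
               + (if j = k then (M *v w) $ i * y $ j else 0))"
        unfolding B_def matrix_vector_mult_def
        by (auto intro!: sum.cong simp: mat_def axis_def algebra_simps)
      also have "\<dots> = (mat 1 *v y) $ i + (M *v w) $ i * y $ k"
        by (simp add: sum.distrib matrix_vector_mult_def)
      finally show ?thesis by (simp add: mult.commute)
    qed
    then show ?thesis by (simp add: vec_eq_iff)
  qed
  \<comment> \<open>Row \<open>k\<close> of \<open>M\<close> turns the functional
    \<open>\<nu>\<close> into a coordinate. No inverse of \<open>M\<close> is formed: this identity
    and \<open>\<nu> $ k \<noteq> 0\<close> allow cancelling \<open>det M\<close>.\<close>
  have "M ** matrix ?f = B ** M"
  proof (rule matrix_eq[THEN iffD2], rule allI)
    fix x
    have "M *v ?f x = B *v (M *v x)"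
      by (simp add: Bv Mv matrix_vector_right_distrib matrix_vector_mult_scaleR)
    then show "(M ** matrix ?f) *v x = (B ** M) *v x"
      by (simp add: matrix_vector_mul_assoc[symmetric] matrix_works lin)
  qed
  then have "det M * det (matrix ?f) = det B * det M"
    by (metis det_mul)
  with detM detB k show ?thesis by simp
qed

text \<open>The library states the change of variables for linear maps only for well-ordered index
  types. Here is a well-ordered copy of an arbitrary finite type.\<close>

typedef 'a ranked = "UNIV :: 'a set"
  by simp

lemma bij_Rep_ranked: "bij Rep_ranked"
  by (metis Abs_ranked_inverse Rep_ranked_inverse UNIV_I bijI')

instance ranked :: (finite) finite
proof
  show "finite (UNIV :: 'a ranked set)"
    by (rule finite_imageD[of Rep_ranked]) (auto simp: inj_on_def Rep_ranked_inject)
qed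

instantiation ranked :: (countable) wellorder
begin

definition less_eq_ranked :: "'a ranked \<Rightarrow> 'a ranked \<Rightarrow> bool" where
  "less_eq_ranked x y \<longleftrightarrow> to_nat (Rep_ranked x) \<le> to_nat (Rep_ranked y)"

definition less_ranked :: "'a ranked \<Rightarrow> 'a ranked \<Rightarrow> bool" where
  "less_ranked x y \<longleftrightarrow> to_nat (Rep_ranked x) < to_nat (Rep_ranked y)"

instance
proof
  fix P :: "'a ranked \<Rightarrow> bool" and a
  assume "\<And>x. (\<And>y. y < x \<Longrightarrow> P y) \<Longrightarrow> P x"
  then show "P a"
    unfolding less_ranked_def
    by (induction a rule: measure_induct_rule[of "\<lambda>x. to_nat (Rep_ranked x)"]) blast
qed (auto simp: less_eq_ranked_def less_ranked_def Rep_ranked_inject)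

end

definition rank_vec :: "real^'n::finite \<Rightarrow> real^('n ranked)" where
  "rank_vec x = (\<chi> i. x $ Rep_ranked i)"

definition unrank_vec :: "real^('n::finite ranked) \<Rightarrow> real^'n" where
  "unrank_vec x = (\<chi> i. x $ Abs_ranked i)"

lemma rank_unrank [simp]: "rank_vec (unrank_vec x) = x" "unrank_vec (rank_vec y) = y"
  by (simp_all add: rank_vec_def unrank_vec_def Rep_ranked_inverse Abs_ranked_inverse vec_eq_iff)

lemma linear_rank_vec: "linear rank_vec" and linear_unrank_vec: "linear unrank_vec"
  by (auto intro!: linearI simp: rank_vec_def unrank_vec_def vec_eq_iff)

lemma inner_rank_vec [simp]: "rank_vec x \<bullet> rank_vec y = x \<bullet> y"
  unfolding inner_vec_def rank_vec_def
  using sum.reindex_bij_betw[OF bij_Rep_ranked, of "\<lambda>i. x $ i \<bullet> y $ i"] by simp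

lemma rank_vec_Basis: "rank_vec ` (Basis :: (real^'n) set) = Basis"
proof -
  have "rank_vec (axis i 1) = axis (Abs_ranked i) 1" for i :: 'n
    by (auto simp: rank_vec_def axis_def vec_eq_iff Rep_ranked_inverse Abs_ranked_inverse)
  moreover have "axis j 1 = rank_vec (axis (Rep_ranked j) 1)" for j :: "'n ranked"
    by (auto simp: rank_vec_def axis_def vec_eq_iff Rep_ranked_inject)
  ultimately show ?thesis
    by (auto simp: Basis_vec_def image_iff)
qed

text \<open>Relabelling coordinates turns boxes into boxes with the same edge lengths, and Lebesgue
  measure is determined by its values on boxes.\<close>

lemma lborel_unrank_vec: "distr lborel borel unrank_vec = (lborel :: (real^'n) measure)"
proof (rule lborel_eqI[symmetric])
  fix l u :: "real^'n"
  assume le: "\<And>b. b \<in> Basis \<Longrightarrow> l \<bullet> b \<le> u \<bullet> b"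
  have inj: "inj_on rank_vec (Basis :: (real^'n) set)"
    by (metis inj_on_inverseI rank_unrank(2))
  have "unrank_vec x \<bullet> b = x \<bullet> rank_vec b" for x :: "real^('n ranked)" and b
    by (metis inner_rank_vec rank_unrank(1))
  then have vim: "unrank_vec -` box l u = box (rank_vec l) (rank_vec u)"
    by (auto simp: box_def rank_vec_Basis[symmetric])
  have "emeasure (distr lborel borel unrank_vec) (box l u) = emeasure lborel (box (rank_vec l) (rank_vec u))"
    by (subst emeasure_distr)
       (auto simp: vim intro!: borel_measurable_continuous_onI linear_continuous_on linear_linear[THEN iffD2] linear_unrank_vec)
  also have "\<dots> = (\<Prod>b\<in>Basis. (rank_vec u - rank_vec l) \<bullet> b)"
    using le by (subst emeasure_lborel_box) (auto simp: rank_vec_Basis[symmetric])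
  also have "\<dots> = (\<Prod>b\<in>Basis. (u - l) \<bullet> b)"
    unfolding rank_vec_Basis[symmetric]
    by (subst prod.reindex[OF inj]) (simp add: linear_diff[OF linear_rank_vec, symmetric])
  finally show "emeasure (distr lborel borel unrank_vec) (box l u) = (\<Prod>b\<in>Basis. (u - l) \<bullet> b)" .
qed simp

lemma measure_rank_vec:
  fixes S :: "(real^'n) set"
  assumes "S \<in> sets borel"
  shows "measure lborel (rank_vec ` S) = measure lborel S"
proof -
  have "rank_vec ` S = unrank_vec -` S"
    by (auto simp: image_iff) (metis rank_unrank(1))
  moreover have "measure (distr lborel borel unrank_vec) S = measure lborel (unrank_vec -` S)"
    using assms
    by (subst measure_distr)
       (auto intro!: borel_measurable_continuous_onI linear_continuous_on linear_linear[THEN iffD2] linear_unrank_vec)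
  ultimately show ?thesis
    by (simp add: lborel_unrank_vec)
qed

text \<open>The relabelling preserves inner products, so it carries the map to one of the same shape
  over the well-ordered index type, where the determinant formula applies. Compactness keeps all
  images Borel.\<close>

lemma measure_rank_one_image:
  fixes w \<nu> :: "real^'n"
  assumes "compact S"
  shows "measure lebesgue ((\<lambda>x. x + (\<nu> \<bullet> x) *\<^sub>R w) ` S) = \<bar>1 + \<nu> \<bullet> w\<bar> * measure lebesgue S"
proof -
  let ?f = "\<lambda>x. x + (\<nu> \<bullet> x) *\<^sub>R w"
  let ?F = "\<lambda>x. x + (rank_vec \<nu> \<bullet> x) *\<^sub>R rank_vec w"
  have lin: "linear ?F"
    by (rule linearI) (simp_all add: inner_add_right scaleR_add_left algebra_simps)
  have comm: "rank_vec (?f x) = ?F (rank_vec x)" for x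
    by (simp add: linear_add[OF linear_rank_vec] linear_scale[OF linear_rank_vec])
  have cr: "compact (rank_vec ` S)"
    by (intro compact_continuous_image assms linear_continuous_on linear_linear[THEN iffD2] linear_rank_vec)
  have cf: "compact (?f ` S)"
    by (intro compact_continuous_image assms continuous_intros)
  have "compact (rank_vec ` ?f ` S)"
    by (intro compact_continuous_image cf linear_continuous_on linear_linear[THEN iffD2] linear_rank_vec)
  note bor = borel_compact[OF cr] borel_compact[OF cf] borel_compact[OF this] borel_compact[OF assms]
  have "measure lebesgue (?f ` S) = measure lebesgue (rank_vec ` ?f ` S)"
    using bor by (simp add: measure_completion measure_rank_vec)
  also have "rank_vec ` ?f ` S = ?F ` (rank_vec ` S)"
    by (auto simp: image_iff comm)
  also have "measure lebesgue \<dots> = \<bar>1 + \<nu> \<bullet> w\<bar> * measure lebesgue (rank_vec ` S)"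
    using measure_linear_image[OF lin lmeasurable_compact[OF cr]]
    by (simp add: det_rank_one_update)
  also have "measure lebesgue (rank_vec ` S) = measure lebesgue S"
    using bor by (simp add: measure_completion measure_rank_vec)
  finally show ?thesis .
qed

lemma measure_affine_rank_one_image:
  fixes w \<nu> :: "real^'n"
  assumes "compact S"
  shows "measure lebesgue ((\<lambda>x. x + (\<nu> \<bullet> x + c) *\<^sub>R w) ` S) = \<bar>1 + \<nu> \<bullet> w\<bar> * measure lebesgue S"
proof -
  have "(\<lambda>x. x + (\<nu> \<bullet> x + c) *\<^sub>R w) ` S = (+) (c *\<^sub>R w) ` (\<lambda>x. x + (\<nu> \<bullet> x) *\<^sub>R w) ` S"
    by (auto simp: image_image algebra_simps)
  then show ?thesis
    by (simp only: measure_translation measure_rank_one_image[OF assms])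
qed

section \<open>Barycentric coordinates\<close>

text \<open>Chosen through its defining equations: the affine function \<open>bary C p\<close> has
  to be 1 at \<open>p\<close> and 0 at every other vertex. For affinely independent \<open>C\<close>
  they are solvable, see \<open>bary_vertex\<close>.\<close>

definition bary_grad :: "'a::euclidean_space set \<Rightarrow> 'a \<Rightarrow> 'a" where
  "bary_grad C p = (SOME g. \<forall>q\<in>C - {p}. g \<bullet> (q - p) = -1)"

definition bary :: "'a::euclidean_space set \<Rightarrow> 'a \<Rightarrow> 'a \<Rightarrow> real" where
  "bary C p x = 1 + bary_grad C p \<bullet> (x - p)"

definition centroid :: "'a::euclidean_space set \<Rightarrow> 'a" where
  "centroid C = (1 / card C) *\<^sub>R \<Sum>C"

lemma bary_eq: "bary C p x = bary_grad C p \<bullet> x + (1 - bary_grad C p \<bullet> p)"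
  by (simp add: bary_def inner_diff_right)

lemma continuous_on_bary [continuous_intros]: "continuous_on S (bary C p)"
  unfolding bary_def[abs_def] by (intro continuous_intros)

lemma bary_diff: "bary C p x - bary C p y = bary_grad C p \<bullet> (x - y)"
  by (simp add: bary_def inner_diff_right)

lemma bary_sum:
  assumes "(\<Sum>q\<in>D. u q) = 1"
  shows "bary C p (\<Sum>q\<in>D. u q *\<^sub>R q) = (\<Sum>q\<in>D. u q * bary C p q)"
proof -
  have "(\<Sum>q\<in>D. u q * bary C p q) = (\<Sum>q\<in>D. u q * (bary_grad C p \<bullet> q)) + (\<Sum>q\<in>D. u q) * (1 - bary_grad C p \<bullet> p)"
    by (simp add: bary_eq distrib_left sum.distrib sum_distrib_right)
  then show ?thesis
    by (simp add: assms bary_eq inner_sum_right)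
qed

lemma bary_line: "bary C p (x + t *\<^sub>R (y - x)) = (1 - t) * bary C p x + t * bary C p y"
  by (simp add: bary_def inner_diff_right inner_add_right algebra_simps)

locale simplex_vertices =
  fixes C :: "(real^'n) set"
  assumes indep: "\<not> affine_dependent C"
    and card: "card C = Suc CARD('n)"
begin

lemma finite: "finite C"
  using card by (intro card_ge_0_finite) simp

text \<open>The edge vectors \<open>q - p\<close> are linearly independent, so a linear functional
  with value -1 on all of them exists; \<open>adjoint f 1\<close> is the vector representing
  it.\<close>

lemma bary_vertex:
  assumes p: "p \<in> C" and q: "q \<in> C"
  shows "bary C p q = (if p = q then 1 else 0)"
proof -
  have ind: "independent ((\<lambda>x. - p + x) ` (C - {p}))"
    using indep affine_dependent_iff_dependent2[OF p] by simp
  obtain f :: "real^'n \<Rightarrow> real" where f: "linear f" "\<forall>x\<in>(\<lambda>x. - p + x) ` (C - {p}). f x = -1"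
    using linear_independent_extend[OF ind, of "\<lambda>_. -1"] by auto
  have "f x = adjoint f 1 \<bullet> x" for x
    using adjoint_works[OF f(1), of x 1] by (simp add: inner_commute)
  then have "\<exists>g. \<forall>q\<in>C - {p}. g \<bullet> (q - p) = -1"
    using f(2) by (intro exI[of _ "adjoint f 1"]) auto
  then have "\<forall>q\<in>C - {p}. bary_grad C p \<bullet> (q - p) = -1"
    unfolding bary_grad_def by (rule someI_ex)
  then show ?thesis
    using q by (auto simp: bary_def)
qed

lemma bary_combination:
  assumes "(\<Sum>q\<in>C. u q) = 1" "p \<in> C"
  shows "bary C p (\<Sum>q\<in>C. u q *\<^sub>R q) = u p"
proof -
  have "bary C p (\<Sum>q\<in>C. u q *\<^sub>R q) = (\<Sum>q\<in>C. if p = q then u q else 0)"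
    unfolding bary_sum[OF assms(1)]
    by (rule sum.cong) (use assms bary_vertex in auto)
  then show ?thesis using finite assms by simp
qed

text \<open>The vertices affinely span the whole space, so every point is an affine combination of
  them, and \<open>bary_combination\<close> identifies the weights.\<close>

lemma
  shows sum_bary: "(\<Sum>p\<in>C. bary C p x) = 1"
    and sum_bary_scaleR: "(\<Sum>p\<in>C. bary C p x *\<^sub>R p) = x"
proof -
  have "aff_dim C = int CARD('n)"
    using aff_dim_affine_independent[OF indep] card by simp
  then have "x \<in> affine hull C"
    using aff_dim_eq_full[of C] by simp
  then obtain u where u: "sum u C = 1" "(\<Sum>v\<in>C. u v *\<^sub>R v) = x"
    using affine_hull_finite[OF finite] by auto
  have "bary C p x = u p" if "p \<in> C" for p
    using bary_combination[OF u(1) that] u(2) by simp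
  then show "(\<Sum>p\<in>C. bary C p x) = 1" "(\<Sum>p\<in>C. bary C p x *\<^sub>R p) = x"
    using u by auto
qed

text \<open>The two identities for \<open>bary\<close>, differentiated in direction
  \<open>h\<close>.\<close>

lemma
  shows sum_bary_grad_inner: "(\<Sum>p\<in>C. bary_grad C p \<bullet> h) = 0"
    and sum_bary_grad_scaleR: "(\<Sum>p\<in>C. (bary_grad C p \<bullet> h) *\<^sub>R p) = h"
proof -
  have *: "bary_grad C p \<bullet> h = bary C p h - bary C p 0" for p
    by (simp add: bary_diff)
  show "(\<Sum>p\<in>C. bary_grad C p \<bullet> h) = 0"
    unfolding * by (simp add: sum_subtractf sum_bary)
  show "(\<Sum>p\<in>C. (bary_grad C p \<bullet> h) *\<^sub>R p) = h"
    unfolding * by (simp add: sum_subtractf scaleR_diff_left sum_bary_scaleR)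
qed

lemma hull_eq: "convex hull C = {x. \<forall>p\<in>C. 0 \<le> bary C p x}"
proof (intro equalityI subsetI CollectI)
  fix x assume "x \<in> convex hull C"
  then obtain u where u: "\<forall>p\<in>C. 0 \<le> u p" "sum u C = 1" "(\<Sum>v\<in>C. u v *\<^sub>R v) = x"
    using convex_hull_finite[OF finite] by auto
  then show "\<forall>p\<in>C. 0 \<le> bary C p x"
    using bary_combination[OF u(2)] by auto
next
  fix x assume "x \<in> {x. \<forall>p\<in>C. 0 \<le> bary C p x}"
  then show "x \<in> convex hull C"
    unfolding convex_hull_finite[OF finite]
    using sum_bary[of x] sum_bary_scaleR[of x] by (auto intro!: exI[of _ "\<lambda>p. bary C p x"])
qed

lemma side_eq:
  assumes "p \<in> C"
  shows "convex hull (C - {p}) = {x \<in> convex hull C. bary C p x = 0}"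
proof (intro equalityI subsetI)
  fix x assume x: "x \<in> convex hull (C - {p})"
  then obtain u where u: "sum u (C - {p}) = 1" "(\<Sum>v\<in>C - {p}. u v *\<^sub>R v) = x"
    using convex_hull_finite[of "C - {p}"] finite by auto
  have "bary C p x = (\<Sum>q\<in>C - {p}. u q * bary C p q)"
    using bary_sum[OF u(1)] u(2) by metis
  also have "\<dots> = 0"
    using assms bary_vertex by (intro sum.neutral) auto
  finally show "x \<in> {x \<in> convex hull C. bary C p x = 0}"
    using x hull_mono[of "C - {p}" C] by auto
next
  fix x assume x: "x \<in> {x \<in> convex hull C. bary C p x = 0}"
  have "(\<Sum>q\<in>C - {p}. bary C q x) = 1" "(\<Sum>q\<in>C - {p}. bary C q x *\<^sub>R q) = x"
    using x sum_bary[of x] sum_bary_scaleR[of x] assms finite by (simp_all add: sum.remove[of C p])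
  then show "x \<in> convex hull (C - {p})"
    using x hull_eq finite by (auto simp: convex_hull_finite intro!: exI[of _ "\<lambda>p. bary C p x"])
qed

lemma compact_hull: "compact (convex hull C)"
  using finite by (rule finite_imp_compact_convex_hull)

lemma interior_supset: "{x. \<forall>p\<in>C. 0 < bary C p x} \<subseteq> interior (convex hull C)"
proof (rule interior_maximal)
  show "open {x. \<forall>p\<in>C. 0 < bary C p x}"
  proof -
    have "{x. \<forall>p\<in>C. 0 < bary C p x} = (\<Inter>p\<in>C. {x. 0 < bary C p x})" by auto
    then show ?thesis
      using finite by (auto intro!: open_INT open_Collect_less continuous_on_bary)
  qed
qed (auto simp: hull_eq intro: less_imp_le)

lemma bary_centroid: "p \<in> C \<Longrightarrow> bary C p (centroid C) = 1 / (1 + real CARD('n))"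
  using bary_combination[of "\<lambda>_. 1 / real (card C)" p] card
  by (simp add: centroid_def scaleR_sum_right)

lemma centroid_interior: "centroid C \<in> interior (convex hull C)"
  using interior_supset bary_centroid by force

lemma measure_hull_pos: "0 < measure lebesgue (convex hull C)"
proof -
  have "\<not> negligible (convex hull C)"
    using centroid_interior open_not_negligible[of "interior (convex hull C)"] interior_subset
    by (metis empty_iff negligible_subset open_interior)
  then show ?thesis
    using compact_hull
    by (metis less_eq_real_def lmeasurable_compact measure_nonneg negligible_iff_measure)
qed

lemma extreme_points: "{v. v extreme_point_of (convex hull C)} = C"
  using extreme_point_of_convex_hull_affine_independent[OF indep] by auto

lemma extreme_points_side: "{v. v extreme_point_of (convex hull (C - {p}))} = C - {p}"
  using extreme_point_of_convex_hull_affine_independent[of "C - {p}"] affine_independent_Diff[OF indep]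
  by auto

lemma facet_iff: "S facet_of (convex hull C) \<longleftrightarrow> (\<exists>p\<in>C. S = convex hull (C - {p}))"
proof -
  \<comment> \<open>The description of the facets of a hull asks for at least two vertices, which
    holds in dimension at least one.\<close>
  have "0 < CARD('n)" by simp
  then have "2 \<le> card C" unfolding card by linarith
  then show ?thesis
    by (auto simp: facet_of_convex_hull_affine_independent_alt[OF indep])
qed

lemma barycenter_side:
  assumes "p \<in> C" "q \<in> C"
  shows "bary C q (barycenter (convex hull (C - {p}))) = (if q = p then 0 else 1 / real CARD('n))"
proof -
  have c: "card (C - {p}) = CARD('n)"
    using assms card finite by simp
  have s: "(\<Sum>r\<in>C. if r = p then 0 else 1 / real CARD('n)) = 1"
    using assms c finite by (simp add: sum.If_cases Int_commute Diff_eq[symmetric] Collect_neg_eq)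
  have "(\<Sum>r\<in>C. (if r = p then 0 else 1 / real CARD('n)) *\<^sub>R r) = (\<Sum>r\<in>C - {p}. (1 / real CARD('n)) *\<^sub>R r)"
    using finite assms by (subst sum.remove[of C p]) (auto intro!: sum.cong)
  then have "barycenter (convex hull (C - {p})) = (\<Sum>r\<in>C. (if r = p then 0 else 1 / real CARD('n)) *\<^sub>R r)"
    by (simp add: barycenter_def Let_def extreme_points_side c scaleR_sum_right)
  then show ?thesis
    using bary_combination[OF s assms(2)] by simp
qed

lemma barycenter_in_side:
  assumes "p \<in> C"
  shows "barycenter (convex hull (C - {p})) \<in> convex hull (C - {p})"
  using barycenter_side[OF assms] assms by (auto simp: side_eq hull_eq)

lemma bary_grad_nz:
  assumes "p \<in> C" shows "bary_grad C p \<noteq> 0"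
proof
  assume "bary_grad C p = 0"
  then have "\<forall>x. bary C p x = 1" by (simp add: bary_def)
  then show False using barycenter_side[OF assms assms] by simp
qed

text \<open>\<open>bary C p\<close> is nonnegative on the simplex and zero on the side opposite
  \<open>p\<close>, so its gradient points inward there; hence the minus sign.\<close>

lemma outward_normal:
  assumes "p \<in> C"
  shows "outward_unit_normal (convex hull C) (convex hull (C - {p}))
           (- (1 / norm (bary_grad C p)) *\<^sub>R bary_grad C p)"
proof -
  let ?g = "bary_grad C p"
  have pos: "0 < norm ?g" using bary_grad_nz[OF assms] by simp
  have *: "(- (1 / norm ?g) *\<^sub>R ?g) \<bullet> x = (1 - ?g \<bullet> p) / norm ?g - bary C p x / norm ?g" for x
    by (simp add: bary_eq field_simps diff_divide_distrib[symmetric])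
  show ?thesis
    unfolding outward_unit_normal_def
  proof (intro conjI exI)
    show "norm (- (1 / norm ?g) *\<^sub>R ?g) = 1" using pos by simp
    show "convex hull C \<subseteq> {x. (- (1 / norm ?g) *\<^sub>R ?g) \<bullet> x \<le> (1 - ?g \<bullet> p) / norm ?g}"
      unfolding * using pos assms by (auto simp: hull_eq)
    show "convex hull (C - {p}) = convex hull C \<inter> {x. (- (1 / norm ?g) *\<^sub>R ?g) \<bullet> x = (1 - ?g \<bullet> p) / norm ?g}"
      unfolding * using pos by (auto simp: side_eq[OF assms])
  qed
qed

text \<open>Two elements with a common side: the affine map that fixes the side and moves the vertex
  \<open>p\<close> to \<open>p'\<close> has rank-one linear part.\<close>

lemma adjacent:
  assumes "simplex_vertices C'" and p: "p \<in> C" "p' \<in> C'" and eq: "C - {p} = C' - {p'}"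
  shows bary_adjacent: "bary C p x = bary C p p' * bary C' p' x"
    and bary_grad_adjacent: "bary_grad C p = bary C p p' *\<^sub>R bary_grad C' p'"
    and measure_adjacent: "measure lebesgue (convex hull C') = \<bar>bary C p p'\<bar> * measure lebesgue (convex hull C)"
proof -
  interpret C': simplex_vertices C' by fact
  have b: "bary C p x = bary C p p' * bary C' p' x" for x
  proof -
    \<comment> \<open>Expand \<open>x\<close> in the coordinates of \<open>C'\<close>: the
      coordinate \<open>bary C p\<close> vanishes at the shared vertices, so only the term of
      \<open>p'\<close> survives.\<close>
    have "bary C p x = bary C p (\<Sum>q\<in>C'. bary C' q x *\<^sub>R q)"
      by (simp add: C'.sum_bary_scaleR)
    also have "\<dots> = (\<Sum>q\<in>C'. bary C' q x * bary C p q)"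
      by (rule bary_sum) (rule C'.sum_bary)
    also have "\<dots> = bary C' p' x * bary C p p' + (\<Sum>q\<in>C' - {p'}. bary C' q x * bary C p q)"
      using p C'.finite by (simp add: sum.remove)
    also have "(\<Sum>q\<in>C' - {p'}. bary C' q x * bary C p q) = 0"
      unfolding eq[symmetric] using bary_vertex p by (intro sum.neutral) auto
    finally show ?thesis by simp
  qed
  then show "bary C p x = bary C p p' * bary C' p' x" .
  have "bary_grad C p \<bullet> x = (bary C p p' *\<^sub>R bary_grad C' p') \<bullet> x" for x
    using b[of x] b[of 0] bary_diff[of C p x 0] bary_diff[of C' p' x 0]
    by (simp add: algebra_simps)
  then show "bary_grad C p = bary C p p' *\<^sub>R bary_grad C' p'"
    using vector_eq_rdot by metis
  let ?A = "\<lambda>x. x + bary C p x *\<^sub>R (p' - p)"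
  have fixed: "?A q = q" if "q \<in> C - {p}" for q
    using that bary_vertex[OF p(1), of q] by auto
  have Ap: "?A p = p'"
    using bary_vertex[OF p(1) p(1)] by simp
  have A_eq: "?A x = (p' - p - (bary_grad C p \<bullet> p) *\<^sub>R (p' - p)) + (x + (bary_grad C p \<bullet> x) *\<^sub>R (p' - p))" for x
    by (simp add: bary_eq algebra_simps)
  have img: "?A ` C = C'"
  proof -
    have "?A ` C = insert (?A p) (?A ` (C - {p}))" using p by auto
    also have "?A ` (C - {p}) = C - {p}" by (rule trans[OF image_cong[OF refl fixed] image_ident])
    finally show ?thesis using Ap eq p by auto
  qed
  have lin: "linear (\<lambda>x. x + (bary_grad C p \<bullet> x) *\<^sub>R (p' - p))"
    by (rule linearI) (simp_all add: inner_add_right scaleR_add_left algebra_simps)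
  have "?A ` (convex hull C) = convex hull (?A ` C)"
    unfolding A_eq
    by (simp only: convex_hull_linear_image[OF lin, symmetric] convex_hull_translation
        image_image[of "(+) (p' - p - (bary_grad C p \<bullet> p) *\<^sub>R (p' - p))" "\<lambda>x. x + (bary_grad C p \<bullet> x) *\<^sub>R (p' - p)", symmetric])
  then have "measure lebesgue (convex hull C') = measure lebesgue (?A ` (convex hull C))"
    by (simp only: img)
  also have "\<dots> = \<bar>1 + bary_grad C p \<bullet> (p' - p)\<bar> * measure lebesgue (convex hull C)"
    unfolding bary_eq by (rule measure_affine_rank_one_image[OF compact_hull])
  finally show "measure lebesgue (convex hull C') = \<bar>bary C p p'\<bar> * measure lebesgue (convex hull C)"
    by (simp only: bary_def)
qed

section \<open>Means of affine functions over a simplex\<close>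

lemma set_integrable_hull:
  fixes f :: "real^'n \<Rightarrow> real"
  assumes "continuous_on UNIV f"
  shows "set_integrable lborel (convex hull C) f"
  unfolding set_integrable_def
  by (rule borel_integrable_compact[OF compact_hull continuous_on_subset[OF assms subset_UNIV]])

text \<open>The affine involution exchanging two vertices preserves Lebesgue measure, so all barycentric
  coordinates have the same mean.\<close>

lemma integral_bary_swap:
  assumes p: "p \<in> C" "q \<in> C"
  shows "integral (convex hull C) (bary C p) = integral (convex hull C) (bary C q)"
proof (cases "p = q")
  case False
  let ?T = "convex hull C"
  \<comment> \<open>\<open>\<nu> \<bullet> x + c\<close> equals
    \<open>bary C p x - bary C q x\<close>. Moving \<open>x\<close> by this amount along
    \<open>q - p\<close> exchanges its two coordinates and keeps all others.\<close>
  define \<nu> where "\<nu> = bary_grad C p - bary_grad C q"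
  define c where "c = (1 - bary_grad C p \<bullet> p) - (1 - bary_grad C q \<bullet> q)"
  define A where "A = (\<lambda>x. x + (\<nu> \<bullet> x + c) *\<^sub>R (q - p))"
  have A_alt: "A x = x + (bary C p x - bary C q x) *\<^sub>R (q - p)" for x
    by (simp add: A_def \<nu>_def c_def bary_eq inner_diff_left algebra_simps)
  have bary_A: "bary C r (A x) = bary C r x + (bary C p x - bary C q x) * (bary C r q - bary C r p)" for r x
    by (simp add: A_alt bary_diff) (simp add: bary_def inner_diff_right inner_add_right algebra_simps)
  have swap: "bary C p (A x) = bary C q x" "bary C q (A x) = bary C p x" for x
    using False p by (simp_all add: bary_A bary_vertex)
  have other: "bary C r (A x) = bary C r x" if "r \<in> C" "r \<noteq> p" "r \<noteq> q" for r x
    using that p by (simp add: bary_A bary_vertex)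
  have inv: "A (A x) = x" for x
    unfolding A_alt[of "A x"] swap by (simp add: A_alt algebra_simps)
  have vimage_A: "A -` X = A ` X" for X
    using inv image_eqI[of _ A "A _" X] by auto
  have inT: "A x \<in> ?T \<longleftrightarrow> x \<in> ?T" for x
    unfolding hull_eq mem_Collect_eq using swap other p by metis
  have cont: "continuous_on UNIV A"
    unfolding A_def by (intro continuous_intros)
  have meas: "A \<in> borel_measurable borel"
    by (rule borel_measurable_continuous_onI[OF cont])
  have bary_meas: "bary C p \<in> borel_measurable borel"
    by (rule borel_measurable_continuous_onI[OF continuous_on_bary])
  have T_meas: "?T \<in> sets borel"
    by (rule borel_compact[OF compact_hull])
  \<comment> \<open>The inner product is (0 - 1) - (1 - 0) = -2, so the determinant is -1, as for a
    reflection.\<close>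
  have det: "\<bar>1 + \<nu> \<bullet> (q - p)\<bar> = 1"
  proof -
    have "\<nu> \<bullet> (q - p) = (bary C p q - bary C p p) - (bary C q q - bary C q p)"
      by (simp add: \<nu>_def bary_diff inner_diff_left)
    then show ?thesis using False p by (simp add: bary_vertex)
  qed
  have dist: "distr lborel borel A = lborel"
  proof (rule lborel_eqI[symmetric])
    fix l u :: "real^'n" assume le: "\<And>b. b \<in> Basis \<Longrightarrow> l \<bullet> b \<le> u \<bullet> b"
    \<comment> \<open>The volume formula is available for compact sets, whereas
      \<open>lborel_eqI\<close> tests open boxes. The closed box is measured first; then its
      boundary, whose image is negligible, is removed.\<close>
    have neg: "negligible (cbox l u - box l u)"
      using negligible_frontier_interval by blast
    have cA: "compact (A ` cbox l u)"
      by (intro compact_continuous_image continuous_on_subset[OF cont]) auto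
    have "emeasure (distr lborel borel A) (cbox l u) = emeasure lborel (A -` cbox l u)"
      using meas by (subst emeasure_distr) auto
    also have "A -` cbox l u = A ` cbox l u"
      by (rule vimage_A)
    also have "emeasure lborel (A ` cbox l u) = ennreal (measure lebesgue (A ` cbox l u))"
      using cA emeasure_eq_ennreal_measure[of lborel "A ` cbox l u"] emeasure_compact_finite[OF cA]
      by (auto simp: borel_compact)
    also have "measure lebesgue (A ` cbox l u) = measure lebesgue (cbox l u)"
      unfolding A_def measure_affine_rank_one_image[OF compact_cbox] det by simp
    finally have *: "emeasure (distr lborel borel A) (cbox l u) = ennreal (\<Prod>b\<in>Basis. (u - l) \<bullet> b)"
      using le by (simp add: content_cbox_cases inner_diff_left)
    show "emeasure (distr lborel borel A) (box l u) = ennreal (\<Prod>b\<in>Basis. (u - l) \<bullet> b)"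
    proof -
      have "A ` (cbox l u - box l u) \<in> null_sets lebesgue"
        unfolding negligible_iff_null_sets[symmetric]
        by (rule negligible_differentiable_image_negligible[OF _ neg])
           (auto simp: A_def intro!: derivative_intros differentiable_at_withinI simp: differentiable_on_def)
      moreover have "A -` (cbox l u - box l u) = A ` (cbox l u - box l u)"
        by (rule vimage_A)
      moreover have "A -` (cbox l u - box l u) \<in> sets borel"
        using measurable_sets[OF meas, of "cbox l u - box l u"] by simp
      ultimately have "cbox l u - box l u \<in> null_sets (distr lborel borel A)"
        using meas by (auto simp: null_sets_def emeasure_distr)
      then have "emeasure (distr lborel borel A) (box l u \<union> (cbox l u - box l u)) = emeasure (distr lborel borel A) (box l u)"
        by (intro emeasure_Un_null_set) auto
      moreover have "box l u \<union> (cbox l u - box l u) = cbox l u"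
        using box_subset_cbox by auto
      ultimately show ?thesis using * by simp
    qed
  qed simp
  have ind: "integral ?T f = (LINT x|lborel. indicat_real ?T x *\<^sub>R f x)" if "continuous_on UNIV f" for f :: "real^'n \<Rightarrow> real"
    using set_borel_integral_eq_integral(2)[OF set_integrable_hull[OF that]]
    by (simp add: set_lebesgue_integral_def)
  have "integral ?T (bary C p) = (LINT x|distr lborel borel A. indicat_real ?T x *\<^sub>R bary C p x)"
    by (simp add: dist ind continuous_on_bary)
  also have "\<dots> = (LINT x|lborel. indicat_real ?T (A x) *\<^sub>R bary C p (A x))"
    by (intro integral_distr) (use meas bary_meas T_meas in measurable)
  also have "\<dots> = integral ?T (bary C q)"
    by (simp add: swap inT indicator_def ind continuous_on_bary)
  finally show ?thesis .
qed simp

lemma bary_integrable: "bary C p integrable_on (convex hull C)"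
  by (rule set_borel_integral_eq_integral(1)[OF set_integrable_hull[OF continuous_on_bary]])

text \<open>All d + 1 coordinates have the same integral, and they sum to 1.\<close>

lemma integral_bary:
  assumes "p \<in> C"
  shows "integral (convex hull C) (bary C p) = measure lebesgue (convex hull C) / (1 + real CARD('n))"
proof -
  let ?T = "convex hull C"
  have "measure lebesgue ?T = integral ?T (\<lambda>x. 1)"
    using compact_hull by (simp add: lmeasure_integral lmeasurable_compact)
  also have "\<dots> = integral ?T (\<lambda>x. \<Sum>q\<in>C. bary C q x)"
    by (simp add: sum_bary)
  also have "\<dots> = (\<Sum>q\<in>C. integral ?T (bary C q))"
    using finite bary_integrable by (intro integral_sum) auto
  also have "\<dots> = (\<Sum>q\<in>C. integral ?T (bary C p))"
    using integral_bary_swap[OF assms] by (intro sum.cong) auto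
  finally show ?thesis using card by (simp add: field_simps)
qed

text \<open>An affine map is the combination of its vertex values weighted by barycentric
  coordinates, and each weight has mean 1 / (d + 1).\<close>

lemma has_integral_affine:
  fixes A :: "real^'n \<Rightarrow> 'b::euclidean_space"
  assumes "linear A"
  shows "((\<lambda>x. A x + c) has_integral measure lebesgue (convex hull C) *\<^sub>R (A (centroid C) + c)) (convex hull C)"
proof -
  let ?T = "convex hull C"
  have "((\<lambda>x. bary C p x *\<^sub>R (A p + c)) has_integral (measure lebesgue ?T / (1 + real CARD('n))) *\<^sub>R (A p + c)) ?T" if "p \<in> C" for p
    using integral_bary[OF that] bary_integrable[of p] by (intro has_integral_scaleR_left) (simp add: has_integral_iff)
  then have "((\<lambda>x. \<Sum>p\<in>C. bary C p x *\<^sub>R (A p + c)) has_integral (\<Sum>p\<in>C. (measure lebesgue ?T / (1 + real CARD('n))) *\<^sub>R (A p + c))) ?T"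
    using finite by (intro has_integral_sum) auto
  moreover have "(\<Sum>p\<in>C. bary C p x *\<^sub>R (A p + c)) = A x + c" for x
  proof -
    have "(\<Sum>p\<in>C. bary C p x *\<^sub>R (A p + c)) = A (\<Sum>p\<in>C. bary C p x *\<^sub>R p) + (\<Sum>p\<in>C. bary C p x) *\<^sub>R c"
      by (simp add: scaleR_add_right sum.distrib linear_sum[OF assms] linear_scale[OF assms] scaleR_sum_left)
    then show ?thesis by (simp add: sum_bary sum_bary_scaleR)
  qed
  moreover have "(\<Sum>p\<in>C. (measure lebesgue ?T / (1 + real CARD('n))) *\<^sub>R (A p + c)) = measure lebesgue ?T *\<^sub>R (A (centroid C) + c)"
  proof -
    have "A (centroid C) + c = (1 / (1 + real CARD('n))) *\<^sub>R (\<Sum>p\<in>C. A p + c)"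
      using card
      by (simp add: centroid_def linear_scale[OF assms] linear_sum[OF assms] sum.distrib scaleR_add_right
          sum_constant_scaleR)
    then show ?thesis by (simp add: scaleR_sum_right)
  qed
  ultimately show ?thesis by simp
qed

text \<open>Write \<open>g p\<close> for \<^term>\<open>bary_grad C p\<close>. For vertices \<open>q \<noteq> p\<close> the number \<open>g p \<bullet> A q\<close> depends on
  \<open>p\<close> only, say it is \<open>\<mu> p\<close>. As the \<open>g p\<close> sum to zero, \<open>\<tau> q = g q \<bullet> A q - \<mu> q\<close> is minus the sum of
  all \<open>\<mu> p\<close>, hence the same for all \<open>q\<close>; it is the factor \<open>b\<close>.\<close>

lemma linear_with_constant_normal_components:
  assumes lin: "linear A"
    and const: "\<And>p x y. p \<in> C \<Longrightarrow> x \<in> convex hull (C - {p}) \<Longrightarrow> y \<in> convex hull (C - {p}) \<Longrightarrow>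
                  bary_grad C p \<bullet> A x = bary_grad C p \<bullet> A y"
  shows "\<exists>b. \<forall>x. A x = b *\<^sub>R x"
proof -
  define \<mu> where "\<mu> p = bary_grad C p \<bullet> A (barycenter (convex hull (C - {p})))" for p
  define \<tau> where "\<tau> q = bary_grad C q \<bullet> A q - \<mu> q" for q
  have M: "bary_grad C p \<bullet> A q = \<mu> p + (if p = q then \<tau> q else 0)" if "p \<in> C" "q \<in> C" for p q
  proof (cases "p = q")
    case False
    then show ?thesis
      using that const[OF that(1) _ barycenter_in_side[OF that(1)], of q] hull_inc[of q "C - {p}" convex]
      by (simp add: \<mu>_def)
  qed (simp add: \<tau>_def)
  have "\<tau> q = - (\<Sum>p\<in>C. \<mu> p)" if "q \<in> C" for q
  proof -
    have "0 = (\<Sum>p\<in>C. bary_grad C p \<bullet> A q)" by (simp add: sum_bary_grad_inner)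
    also have "\<dots> = (\<Sum>p\<in>C. \<mu> p + (if p = q then \<tau> q else 0))"
      using M that by (intro sum.cong) auto
    also have "\<dots> = (\<Sum>p\<in>C. \<mu> p) + \<tau> q"
      using that finite by (simp add: sum.distrib)
    finally show ?thesis by simp
  qed
  then obtain b where b: "\<And>q. q \<in> C \<Longrightarrow> \<tau> q = b" by blast
  \<comment> \<open>\<open>k\<close> collects the part of \<open>A q\<close> that is common to all
    vertices; it turns out to be \<open>A 0\<close>, hence zero.\<close>
  define k where "k = (\<Sum>p\<in>C. \<mu> p *\<^sub>R p)"
  have Aq: "A q = k + b *\<^sub>R q" if "q \<in> C" for q
  proof -
    have "A q = (\<Sum>p\<in>C. (bary_grad C p \<bullet> A q) *\<^sub>R p)" by (simp add: sum_bary_grad_scaleR)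
    also have "\<dots> = (\<Sum>p\<in>C. \<mu> p *\<^sub>R p + (if p = q then b *\<^sub>R p else 0))"
      using M that b by (intro sum.cong) (auto simp: scaleR_add_left)
    also have "\<dots> = k + b *\<^sub>R q"
      using that finite by (simp add: sum.distrib k_def)
    finally show ?thesis .
  qed
  have Ax: "A x = k + b *\<^sub>R x" for x
  proof -
    have "A x = A (\<Sum>q\<in>C. bary C q x *\<^sub>R q)" by (simp add: sum_bary_scaleR)
    also have "\<dots> = (\<Sum>q\<in>C. bary C q x *\<^sub>R A q)"
      by (simp add: linear_sum[OF lin] linear_scale[OF lin])
    also have "\<dots> = (\<Sum>q\<in>C. bary C q x *\<^sub>R k + b *\<^sub>R (bary C q x *\<^sub>R q))"
      using Aq by (intro sum.cong) (auto simp: scaleR_add_right)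
    also have "\<dots> = k + b *\<^sub>R x"
      by (simp only: sum.distrib scaleR_sum_left[symmetric] scaleR_sum_right[symmetric] sum_bary sum_bary_scaleR scaleR_one)
    finally show ?thesis .
  qed
  then have "k = 0" using linear_0[OF lin] by (metis add.right_neutral scaleR_zero_right)
  with Ax show ?thesis by auto
qed

text \<open>The expansion of \<open>v\<close> in the Crouzeix--Raviart basis functions \<open>1 - d \<lambda>\<close>, integrated against \<open>y\<close>.\<close>

lemma element_integration_by_parts:
  fixes G a :: "real^'n" and b w :: real
  defines "v \<equiv> \<lambda>x. G \<bullet> (x - centroid C) + w" and "y \<equiv> \<lambda>x. a + b *\<^sub>R (x - centroid C)"
  shows "G \<bullet> a + w * (real CARD('n) * b) =
    - real CARD('n) * (\<Sum>p\<in>C. v (barycenter (convex hull (C - {p}))) * (bary_grad C p \<bullet> y (barycenter (convex hull (C - {p})))))"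
proof -
  let ?d = "real CARD('n)" and ?s = "\<lambda>p. barycenter (convex hull (C - {p}))"
  have d: "?d > 0" by simp
  have gy: "bary_grad C p \<bullet> y (?s p) = bary_grad C p \<bullet> a - b / (1 + ?d)" if "p \<in> C" for p
  proof -
    have "bary_grad C p \<bullet> (?s p - centroid C) = - 1 / (1 + ?d)"
      using bary_diff[of C p "?s p" "centroid C"] barycenter_side[OF that that] bary_centroid[OF that]
      by simp
    then show ?thesis by (simp add: y_def inner_add_right)
  qed
  have s_eq: "?s p = (1 / ?d) *\<^sub>R ((1 + ?d) *\<^sub>R centroid C - p)" if "p \<in> C" for p
  proof -
    have "?s p = (\<Sum>q\<in>C. bary C q (?s p) *\<^sub>R q)" by (simp add: sum_bary_scaleR)
    also have "\<dots> = (\<Sum>q\<in>C. (1 / ?d) *\<^sub>R q - (if q = p then (1 / ?d) *\<^sub>R q else 0))"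
      using barycenter_side[OF that] by (intro sum.cong) auto
    also have "\<dots> = (1 / ?d) *\<^sub>R (\<Sum>C) - (1 / ?d) *\<^sub>R p"
      using that finite by (simp add: sum_subtractf scaleR_sum_right)
    finally show ?thesis
      using card by (simp add: centroid_def scaleR_diff_right)
  qed
  have vs: "v (?s p) = w - (G \<bullet> (p - centroid C)) / ?d" if "p \<in> C" for p
    unfolding v_def s_eq[OF that] using d
    by (simp add: inner_diff_right field_simps)
  have "(\<Sum>p\<in>C. v (?s p) * (bary_grad C p \<bullet> y (?s p)))
      = (\<Sum>p\<in>C. (w + (G \<bullet> centroid C) / ?d) * (bary_grad C p \<bullet> a) - (w + (G \<bullet> centroid C) / ?d) * (b / (1 + ?d))
           - (1 / ?d) * (G \<bullet> ((bary_grad C p \<bullet> a) *\<^sub>R p)) + (1 / ?d) * (b / (1 + ?d)) * (G \<bullet> p))"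
    by (intro sum.cong refl) (simp only: vs gy inner_diff_right inner_scaleR_right,
      simp add: algebra_simps diff_divide_distrib add_divide_distrib)
  also have "\<dots> = (w + (G \<bullet> centroid C) / ?d) * (\<Sum>p\<in>C. bary_grad C p \<bullet> a) - (1 + ?d) * ((w + (G \<bullet> centroid C) / ?d) * (b / (1 + ?d)))
           - (1 / ?d) * (G \<bullet> (\<Sum>p\<in>C. (bary_grad C p \<bullet> a) *\<^sub>R p)) + (1 / ?d) * (b / (1 + ?d)) * (G \<bullet> \<Sum>C)"
    using card by (simp only: sum.distrib sum_subtractf sum_distrib_left inner_sum_right sum_constant of_nat_Suc)
  also have "\<Sum>C = (1 + ?d) *\<^sub>R centroid C"
    using card by (simp add: centroid_def)
  \<comment> \<open>\<open>X\<close> stands for \<open>G \<bullet> centroid C\<close> and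
    \<open>Y\<close> for \<open>G \<bullet> a\<close>; the terms with \<open>X\<close>
    cancel.\<close>
  moreover have alg: "(w + X / d) * 0 - (1 + d) * ((w + X / d) * (b / (1 + d))) - (1 / d) * Y
      + (1 / d) * (b / (1 + d)) * ((1 + d) * X) = - (w * b) - Y / d" if "d > 0" for d X Y :: real
  proof -
    have "(1 + d) * ((w + X / d) * (b / (1 + d))) = (w + X / d) * b"
      "(1 / d) * (b / (1 + d)) * ((1 + d) * X) = X / d * b"
      using that by simp_all
    then show ?thesis by (simp add: algebra_simps)
  qed
  ultimately have "(\<Sum>p\<in>C. v (?s p) * (bary_grad C p \<bullet> y (?s p))) = - (w * b) - (G \<bullet> a) / ?d"
    by (simp only: sum_bary_grad_inner sum_bary_grad_scaleR inner_scaleR_right alg[OF d])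
  then show ?thesis
    using d by (simp only:) (simp add: field_simps)
qed

end

section \<open>Piecewise affine functions on a simplex\<close>

text \<open>A multi-index of degree at most one is zero or a single unit, so each monomial is
  constant or a coordinate.\<close>

lemma polynomial_le_1_affine:
  fixes p :: "real^'n \<Rightarrow> 'b::real_vector"
  assumes "polynomial_le 1 p"
  obtains A c where "linear A" "\<And>x. p x = A x + c"
proof -
  obtain c :: "('n \<Rightarrow> nat) \<Rightarrow> 'b"
    where c: "\<And>x. p x = (\<Sum>\<alpha> | sum \<alpha> UNIV \<le> 1. (\<Prod>i\<in>UNIV. (x $ i) ^ \<alpha> i) *\<^sub>R c \<alpha>)"
    using assms unfolding polynomial_le_def by blast
  have mono: "\<exists>A k. linear A \<and> (\<forall>x. (\<Prod>i\<in>UNIV. (x $ i) ^ \<alpha> i) *\<^sub>R c \<alpha> = A x + k)"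
    if \<alpha>: "sum \<alpha> UNIV \<le> 1" for \<alpha>
  proof (cases "\<forall>i. \<alpha> i = 0")
    case True
    then show ?thesis by (intro exI[of _ "\<lambda>_. 0"] exI[of _ "c \<alpha>"]) (auto intro: linearI)
  next
    case False
    then obtain j where j: "\<alpha> j \<noteq> 0" by blast
    have s: "sum \<alpha> UNIV = \<alpha> j + sum \<alpha> (UNIV - {j})"
      by (simp add: sum.remove)
    have "sum \<alpha> (UNIV - {j}) = 0" and j1: "\<alpha> j = 1"
      using s \<alpha> j by linarith+
    then have "\<And>i. i \<noteq> j \<Longrightarrow> \<alpha> i = 0"
      by simp
    with j1    have "(\<Prod>i\<in>UNIV. (x $ i) ^ \<alpha> i) = x $ j" for x :: "real^'n"
      by (simp add: prod.remove[of UNIV j])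
    then show ?thesis
      by (intro exI[of _ "\<lambda>x. (x $ j) *\<^sub>R c \<alpha>"] exI[of _ 0])
         (auto intro!: linearI simp: scaleR_add_left)
  qed
  \<comment> \<open>The induction admits an infinite \<open>F\<close>: its sum is 0 by convention,
    which is affine as well.\<close>
  have "\<exists>A k. linear A \<and> (\<forall>x. (\<Sum>\<alpha>\<in>F. (\<Prod>i\<in>UNIV. (x $ i) ^ \<alpha> i) *\<^sub>R c \<alpha>) = A x + k)"
    if "\<forall>\<alpha>\<in>F. sum \<alpha> UNIV \<le> 1" for F
    using that
  proof (induction F rule: infinite_finite_induct)
    case (insert \<alpha> F)
    obtain A k where A: "linear A" "\<And>x. (\<Sum>\<alpha>\<in>F. (\<Prod>i\<in>UNIV. (x $ i) ^ \<alpha> i) *\<^sub>R c \<alpha>) = A x + k"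
      using insert by auto
    obtain B l where B: "linear B" "\<And>x. (\<Prod>i\<in>UNIV. (x $ i) ^ \<alpha> i) *\<^sub>R c \<alpha> = B x + l"
      using insert.prems mono by force
    show ?case
      by (intro exI[of _ "\<lambda>x. B x + A x"] exI[of _ "l + k"])
         (use insert A B in \<open>auto intro!: linear_compose_add\<close>)
  qed (auto intro!: exI[of _ "\<lambda>_. 0"] linearI)
  then have "\<exists>A k. linear A \<and> (\<forall>x. p x = A x + k)"
    unfolding c by simp
  then show ?thesis using that by blast
qed

lemma GDERIV_unique: "GDERIV f x :> D \<Longrightarrow> GDERIV f x :> D' \<Longrightarrow> D = D'"
  unfolding gderiv_def using has_derivative_unique by (metis (no_types, lifting) vector_eq_ldot)

lemma gradient_eqI: "GDERIV f x :> D \<Longrightarrow> gradient f x = D"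
  unfolding gradient_def by (blast intro: GDERIV_unique the_equality)

context simplex_vertices
begin

text \<open>A convex set with an interior point lies in the closure of its interior. This makes the
  filter in \<open>elem_trace\<close> nontrivial, so that the limit is unique.\<close>

lemma islimpt_interior:
  assumes "x \<in> convex hull C" shows "x islimpt interior (convex hull C)"
proof -
  have "x \<in> closure (interior (convex hull C))"
    using assms convex_closure_interior[of "convex hull C"] centroid_interior closure_subset
    by (auto simp: convex_convex_hull)
  then show ?thesis
    using islimpt_closure_open[of "interior (convex hull C)"] limpt_of_closure by auto
qed

lemma elem_trace_eq:
  fixes v :: "real^'n \<Rightarrow> 'b::t2_space"
  assumes "\<And>y. y \<in> interior (convex hull C) \<Longrightarrow> v y = p y" and "continuous_on UNIV p" and x: "x \<in> convex hull C"
  shows "elem_trace (convex hull C) v x = p x"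
  unfolding elem_trace_def
proof (rule tendsto_Lim)
  show "at x within interior (convex hull C) \<noteq> bot"
    using islimpt_interior[OF x] by (simp add: trivial_limit_within)
  have "(p \<longlongrightarrow> p x) (at x within interior (convex hull C))"
    using assms(2) by (metis UNIV_I continuous_on_def subset_UNIV tendsto_within_subset)
  then show "(v \<longlongrightarrow> p x) (at x within interior (convex hull C))"
    by (rule Lim_transform_eventually) (auto simp: eventually_at_filter assms(1))
qed

lemma lmeasurable_hull: "convex hull C \<in> lmeasurable"
  by (rule lmeasurable_compact[OF compact_hull])

lemma negligible_frontier_hull: "negligible (frontier (convex hull C))"
  by (intro negligible_convex_frontier convex_convex_hull)

lemma lebesgue_integral_affine:
  fixes v A :: "real^'n \<Rightarrow> 'b::euclidean_space"
  assumes v: "\<And>y. y \<in> interior (convex hull C) \<Longrightarrow> v y = A y + c" and A: "linear A"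
  shows "(LINT y:convex hull C|lebesgue. v y) = measure lebesgue (convex hull C) *\<^sub>R (A (centroid C) + c)"
proof -
  let ?T = "convex hull C" and ?f = "\<lambda>y. A y + c"
  obtain a where a: "?T \<subseteq> cbox (-a) a"
    using bounded_subset_cbox_symmetric compact_imp_bounded[OF compact_hull] by blast
  have "?f absolutely_integrable_on cbox (-a) a"
    by (intro absolutely_integrable_continuous continuous_intros linear_continuous_on) (simp add: A linear_linear)
  then have "?f absolutely_integrable_on ?T"
    using a lmeasurable_hull by (rule_tac set_integrable_subset) auto
  moreover have eq: "v y = ?f y" if "y \<in> ?T - frontier ?T" for y
    using that v compact_hull by (auto simp: frontier_def compact_imp_closed)
  ultimately have "v absolutely_integrable_on ?T"
    using absolutely_integrable_spike negligible_frontier_hull by blast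
  then have "(LINT y:?T|lebesgue. v y) = integral ?T v"
    by (rule set_lebesgue_integral_eq_integral(2))
  also have "\<dots> = integral ?T ?f"
    using eq by (intro integral_spike[OF negligible_frontier_hull]) auto
  also have "\<dots> = measure lebesgue ?T *\<^sub>R (A (centroid C) + c)"
    by (rule integral_unique[OF has_integral_affine[OF A]])
  finally show ?thesis .
qed

text \<open>The integral is volume times the value at the centroid, where the linear part vanishes.
  This is why functions on an element are expanded about its centroid below.\<close>

lemma mean_affine:
  fixes v A :: "real^'n \<Rightarrow> 'b::euclidean_space"
  assumes v: "\<And>y. y \<in> interior (convex hull C) \<Longrightarrow> v y = A (y - centroid C) + c" and A: "linear A"
  shows "(1 / measure lebesgue (convex hull C)) *\<^sub>R (LINT y:convex hull C|lebesgue. v y) = c"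
proof -
  have "(LINT y:convex hull C|lebesgue. v y) = measure lebesgue (convex hull C) *\<^sub>R c"
    using lebesgue_integral_affine[of v A "c - A (centroid C)"] v A by (simp add: linear_diff[OF A])
  then show ?thesis using measure_hull_pos by simp
qed

lemma gradient_affine:
  assumes "\<And>y. y \<in> interior (convex hull C) \<Longrightarrow> v y = G \<bullet> (y - centroid C) + w"
    and "x \<in> interior (convex hull C)"
  shows "gradient v x = G"
proof (rule gradient_eqI)
  have "((\<lambda>y. G \<bullet> (y - centroid C) + w) has_derivative (\<lambda>h. h \<bullet> G)) (at x)"
    by (auto intro!: derivative_eq_intros simp: inner_commute)
  then show "GDERIV v x :> G"
    unfolding gderiv_def
    by (rule has_derivative_transform_within_open[OF _ open_interior assms(2)]) (simp add: assms(1))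
qed

lemma divergence_affine:
  assumes "\<And>y. y \<in> interior (convex hull C) \<Longrightarrow> v y = a + b *\<^sub>R (y - centroid C)"
    and "x \<in> interior (convex hull C)"
  shows "(\<Sum>i\<in>Basis. frechet_derivative v (at x) i \<bullet> i) = real CARD('n) * b"
proof -
  have "((\<lambda>y. a + b *\<^sub>R (y - centroid C)) has_derivative (\<lambda>h. b *\<^sub>R h)) (at x)"
    by (auto intro!: derivative_eq_intros)
  then have "(v has_derivative (\<lambda>h. b *\<^sub>R h)) (at x)"
    by (rule has_derivative_transform_within_open[OF _ open_interior assms(2)]) (simp add: assms(1))
  then have "frechet_derivative v (at x) = (\<lambda>h. b *\<^sub>R h)"
    using frechet_derivative_at by metis
  then show ?thesis by simp
qed

end

section \<open>Fenchel duality\<close>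

lemma fenchel_young: "f x + fenchel_conj f s \<ge> ereal (s \<bullet> x)" if "f x \<noteq> -\<infinity>" "fenchel_conj f s \<noteq> -\<infinity>"
proof -
  have "ereal (s \<bullet> x) - f x \<le> fenchel_conj f s"
    unfolding fenchel_conj_def by (rule SUP_upper) simp
  then show ?thesis
    using that by (cases "f x"; cases "fenchel_conj f s") (auto simp: algebra_simps)
qed

lemma fenchel_conj_not_MInf:
  assumes "proper_fun f" shows "fenchel_conj f s \<noteq> -\<infinity>"
proof -
  obtain x where x: "f x \<noteq> \<infinity>" "f x \<noteq> -\<infinity>" using assms by (auto simp: proper_fun_def)
  have "ereal (s \<bullet> x) - f x \<le> fenchel_conj f s"
    unfolding fenchel_conj_def by (rule SUP_upper) simp
  then show ?thesis using x by (cases "f x") auto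
qed

text \<open>\<open>F y - s \<bullet> y\<close> has a global minimum at \<open>x\<close>, so its
  derivative vanishes there.\<close>

lemma GDERIV_subgradient:
  fixes F :: "'a::real_inner \<Rightarrow> real"
  assumes F: "GDERIV F x :> D" and sub: "\<And>y. F x + s \<bullet> (y - x) \<le> F y"
  shows "D = s"
proof -
  have "((\<lambda>y. F y - s \<bullet> y) has_derivative (\<lambda>h. h \<bullet> D - s \<bullet> h)) (at x)"
    using F unfolding gderiv_def by (auto intro!: derivative_eq_intros)
  then have "(\<lambda>h. h \<bullet> D - s \<bullet> h) = (\<lambda>h. 0)"
    by (rule differential_zero_maxmin[OF UNIV_I open_UNIV]) (use sub in \<open>auto simp: inner_diff_right algebra_simps\<close>)
  then have "h \<bullet> D = h \<bullet> s" for h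
    by (metis eq_iff_diff_eq_0 inner_commute)
  then show ?thesis using vector_eq_ldot by blast
qed

text \<open>Subtracting the equality at \<open>x\<close> from the Fenchel--Young inequality at
  \<open>y\<close> makes \<open>s\<close> a subgradient of \<open>f\<close> at
  \<open>x\<close>.\<close>

lemma C1_ext_equality:
  assumes C1: "C1_ext f" and eq: "f x = ereal r" "fenchel_conj f s = ereal t" "r + t = s \<bullet> x"
  shows "D_ext f x = s"
proof -
  have fin: "\<bar>f y\<bar> \<noteq> \<infinity>" for y using C1 by (auto simp: C1_ext_def)
  show ?thesis
  proof (rule GDERIV_subgradient)
    show "GDERIV (\<lambda>x. real_of_ereal (f x)) x :> D_ext f x" using C1 by (auto simp: C1_ext_def)
    fix y
    have "f y + fenchel_conj f s \<ge> ereal (s \<bullet> y)" by (rule fenchel_young) (use fin[of y] eq in auto)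
    then show "real_of_ereal (f x) + s \<bullet> (y - x) \<le> real_of_ereal (f y)"
      using fin[of y] eq by (cases "f y") (auto simp: inner_diff_right)
  qed
qed

text \<open>The same inequality, varied in the dual variable, makes \<open>x\<close> a subgradient
  of the conjugate at \<open>s\<close> directly, without passing through the biconjugate.\<close>

lemma C1_ext_conj_equality:
  assumes C1: "C1_ext (fenchel_conj f)" and eq: "f x = ereal r" "fenchel_conj f s = ereal t" "r + t = s \<bullet> x"
  shows "D_ext (fenchel_conj f) s = x"
proof -
  have fin: "\<bar>fenchel_conj f y\<bar> \<noteq> \<infinity>" for y using C1 by (auto simp: C1_ext_def)
  show ?thesis
  proof (rule GDERIV_subgradient)
    show "GDERIV (\<lambda>x. real_of_ereal (fenchel_conj f x)) s :> D_ext (fenchel_conj f) s"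
      using C1 by (auto simp: C1_ext_def)
    fix y
    have "f x + fenchel_conj f y \<ge> ereal (y \<bullet> x)" by (rule fenchel_young) (use fin[of y] eq in auto)
    then show "real_of_ereal (fenchel_conj f s) + x \<bullet> (y - s) \<le> real_of_ereal (fenchel_conj f y)"
      using fin[of y] eq by (cases "fenchel_conj f y") (auto simp: inner_diff_right inner_commute)
  qed
qed

section \<open>Geometry of the triangulation\<close>

text \<open>A slit disc would violate this. Under a Lipschitz graph, a point slightly above the
  graph has a neighbourhood that misses \<Omega>, so it is not in the closure, and frontier points
  have such points arbitrarily near.\<close>

lemma Lipschitz_boundary_interior_closure:
  assumes "open \<Omega>" and lip: "Lipschitz_boundary \<Omega>"
  shows "interior (closure \<Omega>) \<subseteq> \<Omega>"
proof
  fix x assume x: "x \<in> interior (closure \<Omega>)"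
  show "x \<in> \<Omega>"
  proof (rule ccontr)
    assume nx: "x \<notin> \<Omega>"
    then have "x \<in> frontier \<Omega>"
      using x interior_subset \<open>open \<Omega>\<close> by (auto simp: frontier_def interior_open)
    then obtain r e g L where r: "r > 0" and e: "norm e = 1" and g: "L-lipschitz_on {w. w \<bullet> e = 0} g"
      and sub: "\<Omega> \<inter> ball x r = {y \<in> ball x r. y \<bullet> e < g (y - (y \<bullet> e) *\<^sub>R e)}"
      using lip unfolding Lipschitz_boundary_def by blast
    have ee: "e \<bullet> e = 1" using e by (simp add: norm_eq_1)
    define P where "P = (\<lambda>y. y - (y \<bullet> e) *\<^sub>R e)"
    have contP: "continuous_on UNIV P" unfolding P_def by (intro continuous_intros)
    have "continuous_on UNIV (\<lambda>y. g (P y))"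
      by (rule continuous_on_compose2[OF lipschitz_on_continuous_on[OF g] contP])
         (auto simp: P_def inner_diff_left ee)
    then have "continuous_on UNIV (\<lambda>y. y \<bullet> e - g (P y))"
      by (intro continuous_intros)
    then have op: "open {y. y \<bullet> e - g (P y) > 0}"
      using open_Collect_less[of "\<lambda>_. 0" "\<lambda>y. y \<bullet> e - g (P y)"] by simp
    define W where "W = interior (closure \<Omega>) \<inter> ball x r"
    have W: "open W" "x \<in> W" using x r by (auto simp: W_def)
    then obtain d where d: "d > 0" "ball x d \<subseteq> W" using openE by blast
    \<comment> \<open>Moving along \<open>e\<close> leaves \<open>P\<close> unchanged and makes the
      inequality \<open>g (P x) \<le> x \<bullet> e\<close> strict, which is an open
      condition.\<close>
    define z where "z = x + (d / 2) *\<^sub>R e"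
    have zW: "z \<in> W" using d e by (intro subsetD[OF d(2)]) (auto simp: z_def dist_norm)
    have mem: "y \<in> \<Omega> \<longleftrightarrow> y \<bullet> e < g (P y)" if "y \<in> ball x r" for y
    proof -
      have "y \<in> \<Omega> \<inter> ball x r \<longleftrightarrow> y \<bullet> e < g (P y)"
        unfolding sub using that by (simp add: P_def)
      then show ?thesis using that by blast
    qed
    have "g (P x) \<le> x \<bullet> e" using nx mem[of x] r by simp
    moreover have "P z = P x" by (simp add: z_def P_def inner_add_left ee scaleR_add_left)
    moreover have "z \<bullet> e = x \<bullet> e + d / 2" by (simp add: z_def inner_add_left ee)
    ultimately have z: "z \<in> {y. y \<bullet> e - g (P y) > 0} \<inter> W" using d zW by simp
    moreover have "z \<in> closure \<Omega>"
      using zW interior_subset by (auto simp: W_def)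
    ultimately have "({y. y \<bullet> e - g (P y) > 0} \<inter> W) \<inter> \<Omega> \<noteq> {}"
      using open_Int_closure_eq_empty[OF open_Int[OF op W(1)], of \<Omega>] by blast
    then obtain y where y: "y \<in> \<Omega>" "y \<bullet> e - g (P y) > 0" "y \<in> ball x r"
      by (auto simp: W_def)
    then show False using mem[of y] by simp
  qed
qed

section \<open>Elements, their sides and their neighbours\<close>

definition vertices :: "'a::real_vector set \<Rightarrow> 'a set" where
  "vertices T = {v. v extreme_point_of T}"

abbreviation vol :: "(real^'n) set \<Rightarrow> real" where
  "vol T \<equiv> measure lebesgue T"

abbreviation ctr :: "(real^'n) set \<Rightarrow> real^'n" where
  "ctr T \<equiv> centroid (vertices T)"

abbreviation side :: "(real^'n) set \<Rightarrow> real^'n \<Rightarrow> (real^'n) set" where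
  "side T p \<equiv> convex hull (vertices T - {p})"

locale mesh =
  fixes \<Omega> :: "(real^'n) set" and \<T> :: "(real^'n) set set"
  assumes open_domain: "open \<Omega>" and lipschitz: "Lipschitz_boundary \<Omega>"
    and conforming: "conforming_triangulation \<Omega> \<T>"
begin

lemma finite_mesh: "finite \<T>" and Union_mesh: "\<Union>\<T> = closure \<Omega>"
  and face_mesh: "\<And>T T'. T \<in> \<T> \<Longrightarrow> T' \<in> \<T> \<Longrightarrow> (T \<inter> T') face_of T"
  using conforming by (auto simp: conforming_triangulation_def triangulation_def)

lemma simplex_mesh:
  assumes "T \<in> \<T>"
  shows vertices_mesh: "simplex_vertices (vertices T)" and hull_mesh: "convex hull (vertices T) = T"
proof -
  have "int CARD('n) simplex T"
    using conforming assms by (simp add: conforming_triangulation_def)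
  then obtain C where C: "\<not> affine_dependent C" "int (card C) = int CARD('n) + 1" "T = convex hull C"
    unfolding simplex_def by blast
  then have "simplex_vertices C" by unfold_locales auto
  moreover have "vertices T = C"
    using simplex_vertices.extreme_points[OF \<open>simplex_vertices C\<close>] C by (simp add: vertices_def)
  ultimately show "simplex_vertices (vertices T)" "convex hull (vertices T) = T"
    using C by auto
qed

lemma centroid_in_interior: "T \<in> \<T> \<Longrightarrow> ctr T \<in> interior T"
  using simplex_vertices.centroid_interior[OF vertices_mesh] hull_mesh by metis

lemma vol_pos: "T \<in> \<T> \<Longrightarrow> 0 < vol T"
  using simplex_vertices.measure_hull_pos[OF vertices_mesh] hull_mesh by metis

lemma convex_mesh: "T \<in> \<T> \<Longrightarrow> convex T"
  using hull_mesh convex_convex_hull by metis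

lemma compact_mesh: "T \<in> \<T> \<Longrightarrow> compact T"
  using simplex_vertices.compact_hull[OF vertices_mesh] hull_mesh by metis

text \<open>Conformity makes \<open>T \<inter> T'\<close> a face of both elements, and a face that
  meets the interior is the whole element.\<close>

lemma interior_unique:
  assumes "T \<in> \<T>" "T' \<in> \<T>" "x \<in> interior T" "x \<in> T'"
  shows "T = T'"
proof -
  have "x \<in> (T \<inter> T') \<inter> interior T" using assms interior_subset by auto
  then have "T \<inter> T' = T"
    using face_of_disjoint_interior[OF face_mesh[OF assms(1,2)]] by blast
  then have sub: "T \<subseteq> T'" by blast
  then have "x \<in> (T' \<inter> T) \<inter> interior T'"
    using assms interior_mono[OF sub] interior_subset by auto
  then have "T' \<inter> T = T'"
    using face_of_disjoint_interior[OF face_mesh[OF assms(2,1)]] by blast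
  then show ?thesis using sub by blast
qed

lemma interior_subset_domain: "T \<in> \<T> \<Longrightarrow> interior T \<subseteq> \<Omega>"
  using Lipschitz_boundary_interior_closure[OF open_domain lipschitz] Union_mesh
    interior_mono[of T "closure \<Omega>"] by blast

lemma AE_interior: "AE x in lebesgue. x \<in> \<Omega> \<longrightarrow> (\<exists>T\<in>\<T>. x \<in> interior T)"
proof -
  have "negligible (\<Union>T\<in>\<T>. frontier T)"
    using finite_mesh convex_mesh by (intro negligible_Union) (auto intro: negligible_convex_frontier)
  then have "AE x in lebesgue. x \<notin> (\<Union>T\<in>\<T>. frontier T)"
    using negligible_iff_null_sets AE_not_in by blast
  then show ?thesis
  proof (rule AE_mp, intro AE_I2 impI)
    fix x assume x: "x \<notin> (\<Union>T\<in>\<T>. frontier T)" "x \<in> \<Omega>"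
    then obtain T where "T \<in> \<T>" "x \<in> T" using Union_mesh closure_subset by blast
    then show "\<exists>T\<in>\<T>. x \<in> interior T"
      using x closure_subset by (auto simp: frontier_def)
  qed
qed

lemma sum_indicator_interior:
  fixes F :: "(real^'n) set \<Rightarrow> 'b::real_vector"
  assumes "T \<in> \<T>" "x \<in> interior T"
  shows "(\<Sum>T'\<in>\<T>. indicat_real (interior T') x *\<^sub>R F T') = F T"
proof -
  have "(\<Sum>T'\<in>\<T>. indicat_real (interior T') x *\<^sub>R F T') = (\<Sum>T'\<in>\<T>. if T' = T then F T else 0)"
  proof (intro sum.cong refl)
    fix T' assume "T' \<in> \<T>"
    then have "x \<in> interior T' \<longleftrightarrow> T' = T"
      using assms interior_unique interior_subset by blast
    then show "indicat_real (interior T') x *\<^sub>R F T' = (if T' = T then F T else 0)"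
      using assms by (cases "T' = T") auto
  qed
  then show ?thesis using finite_mesh assms by simp
qed

lemma facet_mesh_iff: "T \<in> \<T> \<Longrightarrow> S facet_of T \<longleftrightarrow> (\<exists>p\<in>vertices T. S = side T p)"
  using simplex_vertices.facet_iff[OF vertices_mesh] hull_mesh by metis

lemma side_subset: "T \<in> \<T> \<Longrightarrow> side T p \<subseteq> T"
  using hull_mono[of "vertices T - {p}" "vertices T" convex] hull_mesh by auto

lemma same_side_vertices:
  assumes "T \<in> \<T>" "T' \<in> \<T>" "side T p = side T' p'"
  shows "vertices T - {p} = vertices T' - {p'}"
  using simplex_vertices.extreme_points_side[OF vertices_mesh] assms by metis

text \<open>If \<open>p'\<close> lay on the same side of the common hyperplane as \<open>p\<close>,
  the segment from the barycenter of the side towards \<open>p'\<close> would enter the interior of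
  \<open>T\<close> while staying in \<open>T'\<close>, against
  \<open>interior_unique\<close>.\<close>

lemma opposite_side:
  assumes T: "T \<in> \<T>" "T' \<in> \<T>" "T \<noteq> T'" and p: "p \<in> vertices T" "p' \<in> vertices T'"
    and eq: "side T p = side T' p'"
  shows "bary (vertices T) p p' < 0"
proof (rule ccontr)
  interpret A: simplex_vertices "vertices T" by (rule vertices_mesh[OF T(1)])
  interpret B: simplex_vertices "vertices T'" by (rule vertices_mesh[OF T(2)])
  let ?\<kappa> = "bary (vertices T) p p'"
  assume "\<not> ?\<kappa> < 0"
  moreover have "?\<kappa> \<noteq> 0"
    using A.bary_grad_adjacent[OF B.simplex_vertices_axioms p same_side_vertices[OF T(1,2) eq]]
      A.bary_grad_nz[OF p(1)] by auto
  ultimately have pos: "?\<kappa> > 0" by simp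
  let ?s = "barycenter (side T p)"
  \<comment> \<open>On \<open>?U\<close> all coordinates except that of \<open>p\<close> are
    positive. The barycenter of the side lies in this open set, so a short step stays in it, and the
    step makes the coordinate of \<open>p\<close> positive.\<close>
  let ?U = "\<Inter>q\<in>vertices T - {p}. {x. 0 < bary (vertices T) q x}"
  have op: "open ?U"
    using A.finite by (auto intro!: open_INT open_Collect_less continuous_on_bary)
  have sU: "?s \<in> ?U"
    using A.barycenter_side[OF p(1)] by auto
  have "((\<lambda>t. ?s + t *\<^sub>R (p' - ?s)) \<longlongrightarrow> ?s + 0 *\<^sub>R (p' - ?s)) (at_right 0)"
    by (intro tendsto_intros)
  then have "\<forall>\<^sub>F t in at_right 0. ?s + t *\<^sub>R (p' - ?s) \<in> ?U"
    using topological_tendstoD[OF _ op] sU by simp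
  moreover have "\<forall>\<^sub>F t in at_right 0. t \<in> {0<..<1::real}"
    by (rule eventually_at_right_real) simp
  ultimately have "\<forall>\<^sub>F t in at_right 0. ?s + t *\<^sub>R (p' - ?s) \<in> ?U \<and> t \<in> {0<..<1::real}"
    by (rule eventually_conj)
  then obtain t where t: "?s + t *\<^sub>R (p' - ?s) \<in> ?U" "0 < t" "t < 1"
    using eventually_happens'[OF trivial_limit_at_right_real] by (metis (no_types, lifting) greaterThanLessThan_iff)
  let ?x = "?s + t *\<^sub>R (p' - ?s)"
  have "bary (vertices T) p ?x > 0"
    using pos t by (simp add: bary_line A.barycenter_side[OF p(1) p(1)])
  then have "\<forall>q\<in>vertices T. 0 < bary (vertices T) q ?x"
    using t by auto
  then have "?x \<in> interior T"
    using A.interior_supset hull_mesh[OF T(1)] by auto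
  moreover have "?x \<in> T'"
  proof -
    have "?s \<in> T'"
      using A.barycenter_in_side[OF p(1)] side_subset[OF T(2)] eq by auto
    moreover have "p' \<in> T'"
      using hull_inc[OF p(2)] hull_mesh[OF T(2)] by auto
    ultimately have "(1 - t) *\<^sub>R ?s + t *\<^sub>R p' \<in> T'"
      using convex_mesh[OF T(2)] t by (simp add: convex_alt)
    then show ?thesis by (simp add: algebra_simps)
  qed
  ultimately show False using interior_unique T by blast
qed

text \<open>Leaving \<open>T\<close> through a relatively interior point \<open>z\<close> of the
  side that lies in \<Omega>, one arrives in another element containing \<open>z\<close>. Its
  intersection with \<open>T\<close> is a face containing the side, and the dimension leaves no room
  for more.\<close>

lemma interior_side_neighbour:
  assumes T: "T \<in> \<T>" and p: "p \<in> vertices T" and ninf: "\<not> side T p \<subseteq> frontier \<Omega>"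
  obtains T' p' where "T' \<in> \<T>" "T' \<noteq> T" "p' \<in> vertices T'" "side T' p' = side T p"
proof -
  interpret A: simplex_vertices "vertices T" by (rule vertices_mesh[OF T])
  let ?S = "side T p"
  have facet: "?S facet_of T" using facet_mesh_iff[OF T] p by blast
  have "?S \<subseteq> closure \<Omega>"
    using side_subset[OF T] Union_mesh T by blast
  then obtain x where x: "x \<in> ?S" "x \<in> \<Omega>"
    using ninf open_domain by (auto simp: frontier_def interior_open)
  have "x \<in> closure (rel_interior ?S)"
    using x(1) convex_closure_rel_interior[of ?S] closure_subset by auto
  then obtain z where z: "z \<in> rel_interior ?S" "z \<in> \<Omega>"
    using open_Int_closure_eq_empty[OF open_domain, of "rel_interior ?S"] x(2) by blast
  then have zS: "z \<in> ?S" using rel_interior_subset by blast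
  then have bz: "bary (vertices T) p z = 0" using A.side_eq[OF p] by auto
  \<comment> \<open>All elements missing \<open>z\<close> are cut away, so any element reached by a
    short step contains \<open>z\<close>.\<close>
  define U where "U = \<Omega> - \<Union>{T'\<in>\<T>. z \<notin> T'}"
  have "open U"
    unfolding U_def
    by (rule open_Diff[OF open_domain closed_Union]) (use finite_mesh compact_mesh in \<open>auto intro: compact_imp_closed\<close>)
  moreover have "z \<in> U" using z by (auto simp: U_def)
  moreover have "((\<lambda>t. z + t *\<^sub>R (z - p)) \<longlongrightarrow> z + 0 *\<^sub>R (z - p)) (at_right 0)"
    by (intro tendsto_intros)
  ultimately have "\<forall>\<^sub>F t in at_right 0. z + t *\<^sub>R (z - p) \<in> U"
    using topological_tendstoD by fastforce
  moreover have "\<forall>\<^sub>F t in at_right 0. t > (0::real)"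
    by (rule eventually_at_right_less)
  ultimately have "\<forall>\<^sub>F t in at_right 0. z + t *\<^sub>R (z - p) \<in> U \<and> t > 0"
    by (rule eventually_conj)
  then obtain t where t: "z + t *\<^sub>R (z - p) \<in> U" "t > 0"
    using eventually_happens'[OF trivial_limit_at_right_real] by (metis (no_types, lifting))
  let ?y = "z + t *\<^sub>R (z - p)"
  have "bary (vertices T) p ?y = - t"
    using bary_line[of "vertices T" p z "-t" p] bz A.bary_vertex[OF p p]
    by (simp add: algebra_simps)
  then have yT: "?y \<notin> T"
    using t p A.hull_eq hull_mesh[OF T] by (smt (verit) mem_Collect_eq)
  have "?y \<in> \<Omega>" using t(1) by (simp add: U_def)
  then have "?y \<in> \<Union>\<T>" unfolding Union_mesh using closure_subset by blast
  then obtain T' where T': "T' \<in> \<T>" "?y \<in> T'" by blast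
  then have ne: "T' \<noteq> T" and zT': "z \<in> T'" using yT t by (auto simp: U_def)
  let ?I = "T \<inter> T'"
  \<comment> \<open>A face of \<open>T\<close> that contains a relatively interior point of the side
    contains the whole side.\<close>
  have SI: "?S \<subseteq> ?I"
    by (rule subset_of_face_of[OF face_mesh[OF T T'(1)] side_subset[OF T]])
       (use z zT' zS side_subset[OF T] in blast)
  have "?I \<noteq> T"
    using interior_unique[OF T T'(1) centroid_in_interior[OF T]] ne centroid_in_interior[OF T] interior_subset by blast
  then have lt: "aff_dim ?I < aff_dim T"
    using face_of_aff_dim_lt[OF convex_mesh[OF T] face_mesh[OF T T'(1)]] by blast
  have dimT: "aff_dim T'' = int CARD('n)" if "T'' \<in> \<T>" for T''
    using conforming that aff_dim_simplex by (fastforce simp: conforming_triangulation_def)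
  have S_I: "?S face_of ?I"
    using facet_of_imp_face_of[OF facet] SI by (rule face_of_subset) auto
  have "?S = ?I"
    using face_of_aff_dim_lt[OF convex_Int[OF convex_mesh[OF T] convex_mesh[OF T'(1)]] S_I] lt facet
    by (force simp: facet_of_def)
  then have "?S facet_of T'"
    using face_mesh[OF T'(1) T] facet dimT T T'(1) by (simp add: facet_of_def Int_commute)
  then show thesis using that facet_mesh_iff[OF T'(1)] T' ne by metis
qed

text \<open>Both \<open>p2\<close> and \<open>p3\<close> lie opposite to \<open>p1\<close>; if
  \<open>T2\<close> and \<open>T3\<close> differed, they would also lie opposite to each other. The
  factors multiply by \<open>bary_adjacent\<close>, so a negative number would be the product of two
  negative ones.\<close>

lemma interior_side_unique:
  assumes T: "T1 \<in> \<T>" "T2 \<in> \<T>" "T3 \<in> \<T>"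
    and p: "p1 \<in> vertices T1" "p2 \<in> vertices T2" "p3 \<in> vertices T3"
    and eq: "side T2 p2 = side T1 p1" "side T3 p3 = side T1 p1"
    and ne: "T1 \<noteq> T2" "T1 \<noteq> T3"
  shows "T2 = T3"
proof (rule ccontr)
  assume "T2 \<noteq> T3"
  then have "bary (vertices T2) p2 p3 < 0" "bary (vertices T1) p1 p2 < 0" "bary (vertices T1) p1 p3 < 0"
    using opposite_side T p eq ne by simp_all
  moreover have "bary (vertices T1) p1 p3 = bary (vertices T1) p1 p2 * bary (vertices T2) p2 p3"
    by (rule simplex_vertices.bary_adjacent[OF vertices_mesh[OF T(1)] vertices_mesh[OF T(2)] p(1,2)
          same_side_vertices[OF T(1,2) eq(1)[symmetric]]])
  ultimately show False by (metis mult_neg_neg order.asym)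
qed

end

section \<open>Discrete integration by parts\<close>

lemma elem_trace_cong:
  assumes "\<And>x. x \<in> interior T \<Longrightarrow> v x = v' x"
  shows "elem_trace T v x = elem_trace T v' x"
proof -
  have "\<forall>\<^sub>F y in at x within interior T. v y = v' y"
    by (auto simp: eventually_at_filter assms)
  then show ?thesis
    unfolding elem_trace_def t2_space_class.Lim_def by (simp add: tendsto_cong[of v v'])
qed

lemma L_space_cong:
  assumes "\<And>T x. T \<in> \<T> \<Longrightarrow> x \<in> interior T \<Longrightarrow> v x = v' x"
  shows "v \<in> L_space k \<T> \<longleftrightarrow> v' \<in> L_space k \<T>"
proof -
  have "(\<forall>x\<in>interior T. v x = p x) \<longleftrightarrow> (\<forall>x\<in>interior T. v' x = p x)" if "T \<in> \<T>" for T p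
    using assms[OF that] by simp
  then show ?thesis
    unfolding L_space_def by (simp cong: ball_cong)
qed

text \<open>Transfers membership from an optimizer to the function given by the formula, which
  agrees with it only inside the elements. \<open>RT_N_cong\<close> does the same on the dual
  side.\<close>

lemma CR_D_cong:
  assumes "\<And>T x. T \<in> \<T> \<Longrightarrow> x \<in> interior T \<Longrightarrow> v x = v' x" and "v \<in> CR_D \<Omega> \<Gamma> \<T>"
  shows "v' \<in> CR_D \<Omega> \<Gamma> \<T>"
proof -
  have "elem_trace T v = elem_trace T v'" if "T \<in> \<T>" for T
    using assms(1) that by (intro ext elem_trace_cong) auto
  moreover have "v \<in> L_space 1 \<T> \<longleftrightarrow> v' \<in> L_space 1 \<T>"
    by (rule L_space_cong[OF assms(1)])
  ultimately have "v \<in> CR_D \<Omega> \<Gamma> \<T> \<longleftrightarrow> v' \<in> CR_D \<Omega> \<Gamma> \<T>"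
    unfolding CR_D_def CR_def mem_Collect_eq
    by (simp cong: ball_cong del: One_nat_def)
  with assms(2) show ?thesis by blast
qed

lemma RT_N_cong:
  assumes "\<And>T x. T \<in> \<T> \<Longrightarrow> x \<in> interior T \<Longrightarrow> y x = y' x" and "y \<in> RT_N \<Omega> \<Gamma> \<T>"
  shows "y' \<in> RT_N \<Omega> \<Gamma> \<T>"
proof -
  have "elem_trace T y = elem_trace T y'" if "T \<in> \<T>" for T
    using assms(1) that by (intro ext elem_trace_cong) auto
  moreover have "y \<in> L_space 1 \<T> \<longleftrightarrow> y' \<in> L_space 1 \<T>"
    by (rule L_space_cong[OF assms(1)])
  ultimately have "y \<in> RT_N \<Omega> \<Gamma> \<T> \<longleftrightarrow> y' \<in> RT_N \<Omega> \<Gamma> \<T>"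
    unfolding RT_N_def RT_def mem_Collect_eq
    by (simp cong: ball_cong del: One_nat_def)
  with assms(2) show ?thesis by blast
qed

section \<open>Element coefficients and summation over the mesh\<close>

context mesh
begin

text \<open>Expanding about the centroid makes \<open>G T\<close> the gradient and
  \<open>w T\<close> the mean on \<open>T\<close>.\<close>

definition cr_coeffs :: "(real^'n \<Rightarrow> real) \<Rightarrow> ((real^'n) set \<Rightarrow> real^'n) \<Rightarrow> ((real^'n) set \<Rightarrow> real) \<Rightarrow> bool" where
  "cr_coeffs v G w \<longleftrightarrow> (\<forall>T\<in>\<T>. \<forall>x\<in>interior T. v x = G T \<bullet> (x - ctr T) + w T)"

text \<open>The scalar linear part is what constant normal components force. \<open>a T\<close> is
  the mean, and d times \<open>b T\<close> the divergence.\<close>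

definition rt_coeffs :: "(real^'n \<Rightarrow> real^'n) \<Rightarrow> ((real^'n) set \<Rightarrow> real^'n) \<Rightarrow> ((real^'n) set \<Rightarrow> real) \<Rightarrow> bool" where
  "rt_coeffs y a b \<longleftrightarrow> (\<forall>T\<in>\<T>. \<forall>x\<in>interior T. y x = a T + b T *\<^sub>R (x - ctr T))"

lemma cr_coeffs_exist:
  assumes "v \<in> L_space 1 \<T>"
  obtains G w where "cr_coeffs v G w"
proof -
  have "\<exists>G w. \<forall>x\<in>interior T. v x = G \<bullet> (x - ctr T) + w" if T: "T \<in> \<T>" for T
  proof -
    obtain p where p: "polynomial_le 1 p" "\<And>x. x \<in> interior T \<Longrightarrow> v x = p x"
      using assms T by (auto simp: L_space_def)
    obtain A c where A: "linear A" "\<And>x. p x = A x + c"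
      by (rule polynomial_le_1_affine[OF p(1)]) blast
    have "A x = adjoint A 1 \<bullet> x" for x
      using adjoint_works[OF A(1), of x 1] by (simp add: inner_commute)
    then show ?thesis
      using p(2) A(2)
      by (intro exI[of _ "adjoint A 1"] exI[of _ "adjoint A 1 \<bullet> ctr T + c"]) (auto simp: inner_diff_right)
  qed
  then show ?thesis using that unfolding cr_coeffs_def by metis
qed

lemma
  assumes "cr_coeffs v G w" and T: "T \<in> \<T>"
  shows grad_h_cr: "x \<in> interior T \<Longrightarrow> grad_h \<T> v x = G T"
    and proj0_cr: "x \<in> interior T \<Longrightarrow> proj0 \<T> v x = w T"
    and elem_trace_cr: "x \<in> T \<Longrightarrow> elem_trace T v x = G T \<bullet> (x - ctr T) + w T"
proof -
  interpret simplex_vertices "vertices T" by (rule vertices_mesh[OF T])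
  note hull = hull_mesh[OF T]
  have v: "v x = G T \<bullet> (x - ctr T) + w T" if "x \<in> interior (convex hull (vertices T))" for x
    using assms that hull by (auto simp: cr_coeffs_def)
  show "grad_h \<T> v x = G T" if "x \<in> interior T"
    unfolding grad_h_def sum_indicator_interior[OF T that]
    using gradient_affine[of v "G T" "w T" x] v that hull by simp
  show "proj0 \<T> v x = w T" if "x \<in> interior T"
    unfolding proj0_def sum_indicator_interior[OF T that]
    using mean_affine[of v "\<lambda>x. G T \<bullet> x" "w T"] v hull
    by (simp add: linearI inner_add_right)
  show "elem_trace T v x = G T \<bullet> (x - ctr T) + w T" if "x \<in> T"
  proof -
    have "continuous_on UNIV (\<lambda>x. G T \<bullet> (x - ctr T) + w T)" by (intro continuous_intros)
    then show ?thesis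
      using elem_trace_eq[of v "\<lambda>x. G T \<bullet> (x - ctr T) + w T" x] v that hull by simp
  qed
qed

lemma
  assumes "rt_coeffs y a b" and T: "T \<in> \<T>"
  shows proj0_rt: "x \<in> interior T \<Longrightarrow> proj0 \<T> y x = a T"
    and div_h_rt: "x \<in> interior T \<Longrightarrow> div_h \<T> y x = real CARD('n) * b T"
    and elem_trace_rt: "x \<in> T \<Longrightarrow> elem_trace T y x = a T + b T *\<^sub>R (x - ctr T)"
proof -
  interpret simplex_vertices "vertices T" by (rule vertices_mesh[OF T])
  note hull = hull_mesh[OF T]
  have y: "y x = a T + b T *\<^sub>R (x - ctr T)" if "x \<in> interior (convex hull (vertices T))" for x
    using assms that hull by (auto simp: rt_coeffs_def)
  show "proj0 \<T> y x = a T" if "x \<in> interior T"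
    unfolding proj0_def sum_indicator_interior[OF T that]
    using mean_affine[of y "\<lambda>x. b T *\<^sub>R x" "a T"] y hull
    by (simp add: linearI scaleR_add_right)
  show "div_h \<T> y x = real CARD('n) * b T" if "x \<in> interior T"
    unfolding div_h_def real_scaleR_def[symmetric] sum_indicator_interior[OF T that]
    using divergence_affine[of y "a T" "b T" x] y that hull by simp
  show "elem_trace T y x = a T + b T *\<^sub>R (x - ctr T)" if "x \<in> T"
  proof -
    have "continuous_on UNIV (\<lambda>x. a T + b T *\<^sub>R (x - ctr T))" by (intro continuous_intros)
    then show ?thesis
      using elem_trace_eq[of y "\<lambda>x. a T + b T *\<^sub>R (x - ctr T)" x] y that hull by simp
  qed
qed

lemma proj0_id:
  assumes "T \<in> \<T>" "x \<in> interior T"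
  shows "proj0 \<T> (\<lambda>y. y) x = ctr T"
  using proj0_rt[of "\<lambda>y. y" "\<lambda>T. ctr T" "\<lambda>_. 1", OF _ assms] by (simp add: rt_coeffs_def)

lemma normal_mesh:
  assumes "T \<in> \<T>" "p \<in> vertices T"
  shows "outward_unit_normal T (side T p) (- (1 / norm (bary_grad (vertices T) p)) *\<^sub>R bary_grad (vertices T) p)"
  using simplex_vertices.outward_normal[OF vertices_mesh] hull_mesh assms by metis

lemma RT_normal_const:
  assumes y: "y \<in> RT \<Omega> \<T>" and T: "T \<in> \<T>" "p \<in> vertices T" and x: "x \<in> side T p" "x' \<in> side T p"
  shows "bary_grad (vertices T) p \<bullet> elem_trace T y x = bary_grad (vertices T) p \<bullet> elem_trace T y x'"
proof -
  let ?g = "bary_grad (vertices T) p"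
  have nz: "?g \<noteq> 0" by (rule simplex_vertices.bary_grad_nz[OF vertices_mesh[OF T(1)] T(2)])
  have "side T p facet_of T" using facet_mesh_iff T by blast
  moreover have "\<forall>S n. S facet_of T \<and> outward_unit_normal T S n \<longrightarrow> (\<exists>c. \<forall>x\<in>S. elem_trace T y x \<bullet> n = c)"
    using y T(1) by (simp add: RT_def)
  ultimately obtain c where c: "\<forall>z\<in>side T p. elem_trace T y z \<bullet> (- (1 / norm ?g) *\<^sub>R ?g) = c"
    using normal_mesh[OF T] by presburger
  then have "elem_trace T y x \<bullet> (- (1 / norm ?g) *\<^sub>R ?g) = elem_trace T y x' \<bullet> (- (1 / norm ?g) *\<^sub>R ?g)"
    using x by simp
  with nz show ?thesis by (simp add: inner_commute)
qed

lemma rt_coeffs_exist: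
  assumes "y \<in> RT \<Omega> \<T>"
  obtains a b where "rt_coeffs y a b"
proof -
  have "\<exists>a b. \<forall>x\<in>interior T. y x = a + b *\<^sub>R (x - ctr T)" if T: "T \<in> \<T>" for T
  proof -
    interpret simplex_vertices "vertices T" by (rule vertices_mesh[OF T])
    note hull = hull_mesh[OF T]
    obtain p where p: "polynomial_le 1 p" "\<And>x. x \<in> interior T \<Longrightarrow> y x = p x"
      using assms T by (auto simp: L_space_def RT_def)
    obtain A c where A: "linear A" "\<And>x. p x = A x + c"
      by (rule polynomial_le_1_affine[OF p(1)]) blast
    have cont: "continuous_on UNIV (\<lambda>x. A x + c)"
      by (intro continuous_intros linear_continuous_on) (simp add: A linear_linear)
    have trace: "elem_trace T y x = A x + c" if "x \<in> T" for x
      using elem_trace_eq[of y "\<lambda>x. A x + c" x] p A cont that hull by simp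
    have "\<exists>b. \<forall>x. A x = b *\<^sub>R x"
    proof (rule linear_with_constant_normal_components[OF A(1)])
      fix q x x' assume q: "q \<in> vertices T" and x: "x \<in> side T q" "x' \<in> side T q"
      then have "x \<in> T" "x' \<in> T" using side_subset[OF T] by auto
      then show "bary_grad (vertices T) q \<bullet> A x = bary_grad (vertices T) q \<bullet> A x'"
        using RT_normal_const[OF assms T q x] by (simp add: trace inner_add_right)
    qed
    then obtain b where "\<And>x. A x = b *\<^sub>R x" by blast
    then show ?thesis
      using p(2) A(2) by (intro exI[of _ "b *\<^sub>R ctr T + c"] exI[of _ b]) (auto simp: algebra_simps)
  qed
  then show ?thesis using that unfolding rt_coeffs_def by metis
qed

text \<open>Both sides of an interior side contribute with opposite signs, since \<open>vol T *\<^sub>R bary_grad\<close> is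
  up to a constant factor the inward normal scaled by the area of the side. On the
  boundary one of the two factors vanishes.\<close>

lemma integration_by_parts:
  assumes part: "boundary_partition \<Omega> \<Gamma>\<^sub>D \<Gamma>\<^sub>N"
    and v: "v \<in> CR_D \<Omega> \<Gamma>\<^sub>D \<T>" "cr_coeffs v G w"
    and y: "y \<in> RT_N \<Omega> \<Gamma>\<^sub>N \<T>" "rt_coeffs y a b"
  shows "(\<Sum>T\<in>\<T>. vol T * (G T \<bullet> a T + w T * (real CARD('n) * b T))) = 0"
proof -
  \<comment> \<open>A pair of an element and a vertex stands for the element with the side opposite
    that vertex. Fibres of \<open>\<sigma>\<close> collect the elements that share a side, and
    \<open>h\<close> is the contribution of one pair.\<close>
  define X where "X = Sigma \<T> vertices"
  define \<sigma> where "\<sigma> = (\<lambda>(T :: (real^'n) set, p). side T p)"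
  define h where "h = (\<lambda>(T, p). vol T * (elem_trace T v (barycenter (side T p)) *
      (bary_grad (vertices T) p \<bullet> elem_trace T y (barycenter (side T p)))))"
  have finX: "finite X"
    unfolding X_def using finite_mesh simplex_vertices.finite[OF vertices_mesh] by auto
  have bc: "barycenter (side T p) \<in> side T p" if "T \<in> \<T>" "p \<in> vertices T" for T p
    using simplex_vertices.barycenter_in_side[OF vertices_mesh] that by blast
  have "G T \<bullet> a T + w T * (real CARD('n) * b T)
      = - real CARD('n) * (\<Sum>p\<in>vertices T. elem_trace T v (barycenter (side T p)) *
      (bary_grad (vertices T) p \<bullet> elem_trace T y (barycenter (side T p))))" if T: "T \<in> \<T>" for T
  proof -
    have "barycenter (side T p) \<in> T" if "p \<in> vertices T" for p
      using bc[OF T that] side_subset[OF T] by blast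
    then show ?thesis
      unfolding simplex_vertices.element_integration_by_parts[OF vertices_mesh[OF T]]
      by (simp add: elem_trace_cr[OF v(2) T] elem_trace_rt[OF y(2) T])
  qed
  then have "(\<Sum>T\<in>\<T>. vol T * (G T \<bullet> a T + w T * (real CARD('n) * b T)))
      = - real CARD('n) * (\<Sum>T\<in>\<T>. \<Sum>p\<in>vertices T. h (T, p))"
    by (simp add: h_def sum_distrib_left sum_negf mult_ac)
  also have "(\<Sum>T\<in>\<T>. \<Sum>p\<in>vertices T. h (T, p)) = (\<Sum>x\<in>X. h x)"
    unfolding X_def using finite_mesh simplex_vertices.finite[OF vertices_mesh]
    by (subst sum.Sigma) auto
  also have "\<dots> = (\<Sum>S\<in>\<sigma> ` X. \<Sum>x | x \<in> X \<and> \<sigma> x = S. h x)"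
    by (rule sum.image_gen[OF finX])
  also have "\<dots> = 0"
  proof (rule sum.neutral, rule ballI)
    fix S assume "S \<in> \<sigma> ` X"
    then obtain T p where T: "T \<in> \<T>" "p \<in> vertices T" "S = side T p"
      by (auto simp: X_def \<sigma>_def)
    have S_sides: "S \<in> sides \<T>"
      using T facet_mesh_iff[OF T(1)] by (auto simp: sides_def)
    show "(\<Sum>x | x \<in> X \<and> \<sigma> x = S. h x) = 0"
    proof (cases "S \<subseteq> frontier \<Omega>")
      case bdry: True
      have "h (T', p') = 0" if T': "T' \<in> \<T>" "p' \<in> vertices T'" "side T' p' = S" for T' p'
      proof (cases "S \<subseteq> \<Gamma>\<^sub>D")
        case True
        moreover have "S facet_of T'" using T' facet_mesh_iff by blast
        ultimately have "elem_trace T' v (barycenter S) = 0"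
          using v(1) S_sides T'(1) unfolding CR_D_def by blast
        then show ?thesis using T' by (simp add: h_def)
      next
        case False
        \<comment> \<open>\<open>RT_N\<close> gives a zero only at points of
          \<open>\<Gamma>\<^sub>N\<close>. One such point of the side is enough, because the normal
          component is constant along the side; this carries the zero to the barycenter.\<close>
        then obtain x where x: "x \<in> S" "x \<in> \<Gamma>\<^sub>N"
          using bdry part by (auto simp: boundary_partition_def)
        have "S \<in> boundary_sides \<Omega> \<T>" using bdry S_sides by (simp add: boundary_sides_def)
        moreover have "S facet_of T'" using T' facet_mesh_iff by blast
        moreover note normal_mesh[OF T'(1,2)]
        ultimately have "elem_trace T' y x \<bullet> (- (1 / norm (bary_grad (vertices T') p')) *\<^sub>R bary_grad (vertices T') p') = 0"
          using y(1) x T' unfolding RT_N_def by blast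
        then have "bary_grad (vertices T') p' \<bullet> elem_trace T' y x = 0"
          by (auto simp: inner_commute)
        then have "bary_grad (vertices T') p' \<bullet> elem_trace T' y (barycenter S) = 0"
          using RT_normal_const[of y T' p' x "barycenter S"] y(1) T' x bc[OF T'(1,2)]
          by (auto simp: RT_N_def)
        then show ?thesis using T' by (simp add: h_def)
      qed
      then show ?thesis by (intro sum.neutral) (auto simp: X_def \<sigma>_def)
    next
      case False
      then obtain T' p' where T': "T' \<in> \<T>" "T' \<noteq> T" "p' \<in> vertices T'" "side T' p' = side T p"
        using interior_side_neighbour[OF T(1,2)] T(3) by metis
      have S_int: "S \<in> interior_sides \<Omega> \<T>"
        using False S_sides by (simp add: interior_sides_def boundary_sides_def)
      have vertex_unique: "q = q'" if "T'' \<in> \<T>" "q \<in> vertices T''" "q' \<in> vertices T''" "side T'' q = side T'' q'" for T'' q q'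
        using same_side_vertices[OF that(1,1,4)] that by auto
      have "{x \<in> X. \<sigma> x = S} = {(T, p), (T', p')}"
      proof (intro equalityI subsetI)
        fix x assume "x \<in> {x \<in> X. \<sigma> x = S}"
        then obtain T'' p'' where x: "x = (T'', p'')" "T'' \<in> \<T>" "p'' \<in> vertices T''" "side T'' p'' = side T p"
          using T by (auto simp: X_def \<sigma>_def)
        show "x \<in> {(T, p), (T', p')}"
        proof (cases "T'' = T")
          case True
          then have "p'' = p" using vertex_unique[OF T(1) _ T(2)] x by simp
          with True x show ?thesis by simp
        next
          case False
          then have "T'' = T'"
            using interior_side_unique[OF T(1) T'(1) x(2) T(2) T'(3) x(3) T'(4) x(4)] T'(2) by auto
          moreover have "p'' = p'"
            using vertex_unique[OF T'(1) _ T'(3)] x T' \<open>T'' = T'\<close> by simp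
          ultimately show ?thesis using x by simp
        qed
      qed (use T T' in \<open>auto simp: X_def \<sigma>_def\<close>)
      then have "(\<Sum>x | x \<in> X \<and> \<sigma> x = S. h x) = h (T, p) + h (T', p')"
        using T'(2) by auto
      also have "\<dots> = 0"
      proof -
        let ?s = "barycenter S" and ?\<kappa> = "bary (vertices T) p p'"
        let ?g = "bary_grad (vertices T) p" and ?g' = "bary_grad (vertices T') p'"
        note sv = vertices_mesh[OF T(1)] vertices_mesh[OF T'(1)]
        note adj = same_side_vertices[OF T(1) T'(1) T'(4)[symmetric]]
        have facets: "S facet_of T" "S facet_of T'" using T T' facet_mesh_iff by blast+
        have vs: "elem_trace T v ?s = elem_trace T' v ?s"
          using v(1) S_int facets T(1) T'(1) unfolding CR_D_def CR_def by blast
        have "elem_trace T y ?s \<bullet> (- (1 / norm ?g) *\<^sub>R ?g) = elem_trace T' y ?s \<bullet> (- (1 / norm ?g) *\<^sub>R ?g)"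
          using y(1) S_int facets T T'(1) bc[OF T(1,2)] normal_mesh[OF T(1,2)] unfolding RT_N_def RT_def by blast
        then have ys: "?g \<bullet> elem_trace T y ?s = ?g \<bullet> elem_trace T' y ?s"
          using simplex_vertices.bary_grad_nz[OF sv(1) T(2)] by (simp add: inner_commute)
        have neg: "?\<kappa> < 0"
          by (rule opposite_side[OF T(1) T'(1) T'(2)[symmetric] T(2) T'(3) T'(4)[symmetric]])
        \<comment> \<open>With the volume relation below,
          \<open>vol T *\<^sub>R ?g = - vol T' *\<^sub>R ?g'\<close>: the two scaled normals are
          opposite.\<close>
        have gg: "?g = ?\<kappa> *\<^sub>R ?g'"
          by (rule simplex_vertices.bary_grad_adjacent[OF sv T(2) T'(3) adj])
        have "vol T' = \<bar>?\<kappa>\<bar> * vol T"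
          using simplex_vertices.measure_adjacent[OF sv T(2) T'(3) adj] hull_mesh T(1) T'(1) by simp
        then have vols: "vol T' = - ?\<kappa> * vol T" using neg by simp
        have "?g \<bullet> elem_trace T' y ?s = ?\<kappa> * (?g' \<bullet> elem_trace T' y ?s)"
          by (subst gg) simp
        then have "h (T, p) = vol T * (elem_trace T' v ?s * (?\<kappa> * (?g' \<bullet> elem_trace T' y ?s)))"
          using T(3) vs ys by (simp add: h_def)
        moreover have "h (T', p') = - ?\<kappa> * vol T * (elem_trace T' v ?s * (?g' \<bullet> elem_trace T' y ?s))"
          using T(3) T'(4) vols by (simp add: h_def)
        ultimately show ?thesis by (simp add: algebra_simps)
      qed
      finally show ?thesis .
    qed
  qed
  finally show ?thesis by simp
qed

section \<open>Integrals of element-wise constant functions\<close>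

lemma nn_integral_elementwise:
  assumes f: "\<And>T x. T \<in> \<T> \<Longrightarrow> x \<in> interior T \<Longrightarrow> f x = c T"
  shows "(\<integral>\<^sup>+x\<in>\<Omega>. f x \<partial>lebesgue) = (\<Sum>T\<in>\<T>. c T * ennreal (vol T))"
proof -
  \<comment> \<open>Off the negligible frontiers, the integrand is a finite combination of
    indicators of element interiors, all contained in \<Omega>.\<close>
  have "AE x in lebesgue. f x * indicator \<Omega> x = (\<Sum>T\<in>\<T>. c T * indicator (interior T) x)"
    using AE_interior
  proof (rule AE_mp, intro AE_I2 impI)
    fix x assume x: "x \<in> \<Omega> \<longrightarrow> (\<exists>T\<in>\<T>. x \<in> interior T)"
    show "f x * indicator \<Omega> x = (\<Sum>T\<in>\<T>. c T * indicator (interior T) x)"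
    proof (cases "\<exists>T\<in>\<T>. x \<in> interior T")
      case True
      then obtain T where T: "T \<in> \<T>" "x \<in> interior T" by blast
      have "(\<Sum>T'\<in>\<T>. c T' * indicator (interior T') x) = (\<Sum>T'\<in>\<T>. if T' = T then c T else 0)"
      proof (intro sum.cong refl)
        fix T' assume "T' \<in> \<T>"
        then have "x \<in> interior T' \<longleftrightarrow> T' = T"
          using T interior_unique interior_subset by blast
        then show "c T' * indicator (interior T') x = (if T' = T then c T else 0)"
          using T by (cases "T' = T") auto
      qed
      then show ?thesis
        using T finite_mesh f interior_subset_domain[OF T(1)] by auto
    next
      case False
      then have "x \<notin> \<Omega>" using x by blast
      then show ?thesis using False by simp
    qed
  qed
  then have "(\<integral>\<^sup>+x\<in>\<Omega>. f x \<partial>lebesgue) = (\<integral>\<^sup>+x. (\<Sum>T\<in>\<T>. c T * indicator (interior T) x) \<partial>lebesgue)"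
    by (rule nn_integral_cong_AE)
  also have "\<dots> = (\<Sum>T\<in>\<T>. c T * emeasure lebesgue (interior T))"
    by (subst nn_integral_sum)
       (auto simp: nn_integral_cmult_indicator intro!: sum.cong borel_measurable_times_ennreal borel_measurable_indicator)
  also have "\<dots> = (\<Sum>T\<in>\<T>. c T * ennreal (vol T))"
  proof (intro sum.cong refl)
    fix T assume T: "T \<in> \<T>"
    have "bounded T" using compact_mesh[OF T] compact_imp_bounded by blast
    then have "interior T \<in> lmeasurable" "measure lebesgue (interior T) = vol T"
      using measure_interior negligible_convex_frontier[OF convex_mesh[OF T]]
        lmeasurable_open bounded_subset[OF _ interior_subset] open_interior by blast+
    then show "c T * emeasure lebesgue (interior T) = c T * ennreal (vol T)"
      by (simp add: emeasure_eq_measure2)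
  qed
  finally show ?thesis .
qed

text \<open>Without the value -\<infinity>, the negative part has a finite integral, so the
  difference is meaningful. As elements have positive volume, a single infinite value already makes
  the integral infinite.\<close>

lemma ext_integral_elementwise:
  assumes "\<forall>T\<in>\<T>. \<forall>x\<in>interior T. f x = c T"
    and "\<forall>T\<in>\<T>. c T \<noteq> -\<infinity>"
  shows "ext_integral \<Omega> f \<noteq> -\<infinity>"
    and "ext_integral \<Omega> f \<noteq> \<infinity> \<Longrightarrow> T \<in> \<T> \<Longrightarrow> c T \<noteq> \<infinity>"
    and "ext_integral \<Omega> f \<noteq> \<infinity> \<Longrightarrow> ext_integral \<Omega> f = ereal (\<Sum>T\<in>\<T>. vol T * real_of_ereal (c T))"
proof -
  note f = assms(1)[rule_format] and c = assms(2)[rule_format]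
  define P where "P = (\<Sum>T\<in>\<T>. e2ennreal (c T) * ennreal (vol T))"
  define N where "N = (\<Sum>T\<in>\<T>. e2ennreal (- c T) * ennreal (vol T))"
  have int: "ext_integral \<Omega> f = enn2ereal P - enn2ereal N"
    unfolding ext_integral_def P_def N_def
    by (subst (1 2) nn_integral_elementwise) (auto simp: f)
  have cases: "(\<exists>r. c T = ereal r) \<or> c T = \<infinity>" if "T \<in> \<T>" for T
    using c[OF that] by (cases "c T") auto
  have "e2ennreal (- c T) \<noteq> top" if "T \<in> \<T>" for T
    using cases[OF that] by (auto simp: e2ennreal_neg)
  then have N: "N \<noteq> top"
    unfolding N_def using finite_mesh by (auto simp: ennreal_mult_eq_top_iff)
  then obtain r where r: "enn2ereal N = ereal r"
    by (cases N) auto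
  have P0: "enn2ereal P \<ge> 0" by simp
  show "ext_integral \<Omega> f \<noteq> -\<infinity>"
    using P0 unfolding int r by (cases "enn2ereal P") auto
  assume "ext_integral \<Omega> f \<noteq> \<infinity>"
  then have Pfin: "P \<noteq> top" unfolding int r by (auto simp: enn2ereal_top)
  show fin: "c T \<noteq> \<infinity>" if T: "T \<in> \<T>" for T
  proof
    assume "c T = \<infinity>"
    then have "e2ennreal (c T) * ennreal (vol T) = top"
      using vol_pos[OF T] by (auto simp: ennreal_mult_eq_top_iff ennreal_top_mult)
    then show False using Pfin T finite_mesh unfolding P_def by auto
  qed
  have real: "c T = ereal (real_of_ereal (c T))" if "T \<in> \<T>" for T
    using fin[OF that] c[OF that] by (cases "c T") auto
  let ?r = "\<lambda>T. real_of_ereal (c T)"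
  \<comment> \<open>The coercion truncates negative reals to 0; writing the truncation as a maximum
    turns positive and negative parts into real sums.\<close>
  have ennreal_max_0: "ennreal t = ennreal (max 0 t)" for t
    by (cases "0 \<le> t") (simp_all add: ennreal_neg)
  have "P = (\<Sum>T\<in>\<T>. ennreal (max 0 (?r T) * vol T))"
    unfolding P_def
  proof (intro sum.cong refl)
    fix T assume T: "T \<in> \<T>"
    have "e2ennreal (c T) = ennreal (max 0 (?r T))"
      using ennreal_max_0[of "?r T"] real[OF T] by (metis e2ennreal_ereal)
    then show "e2ennreal (c T) * ennreal (vol T) = ennreal (max 0 (?r T) * vol T)"
      by (simp add: ennreal_mult)
  qed
  then have P_eq: "enn2ereal P = ereal (\<Sum>T\<in>\<T>. max 0 (?r T) * vol T)"
    by (simp add: sum_ennreal sum_nonneg)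
  have "N = (\<Sum>T\<in>\<T>. ennreal (max 0 (- ?r T) * vol T))"
    unfolding N_def
  proof (intro sum.cong refl)
    fix T assume T: "T \<in> \<T>"
    have "e2ennreal (- c T) = ennreal (max 0 (- ?r T))"
      using ennreal_max_0[of "- ?r T"] real[OF T] by (metis e2ennreal_ereal uminus_ereal.simps(1))
    then show "e2ennreal (- c T) * ennreal (vol T) = ennreal (max 0 (- ?r T) * vol T)"
      by (simp add: ennreal_mult)
  qed
  then have N_eq: "enn2ereal N = ereal (\<Sum>T\<in>\<T>. max 0 (- ?r T) * vol T)"
    by (simp add: sum_ennreal sum_nonneg)
  have pos_neg: "max 0 t * m - max 0 (- t) * m = m * t" for t m :: real
    by (simp add: max_def)
  show "ext_integral \<Omega> f = ereal (\<Sum>T\<in>\<T>. vol T * ?r T)"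
    unfolding int P_eq N_eq by (simp only: ereal_minus sum_subtractf[symmetric] pos_neg)
qed

end

section \<open>Optimality conditions on the elements\<close>

context mesh
begin

text \<open>The interior of an element is a non-null open subset of \<Omega>, so a property that
  fails at its centroid would fail on a set of positive measure. The centroid serves as
  representative point.\<close>

lemma AE_elementwise:
  assumes AE: "AE x in lebesgue_on \<Omega>. P (\<psi> x)"
    and const: "\<forall>T\<in>\<T>. \<forall>x\<in>interior T. \<psi> x = \<psi> (ctr T)"
    and T: "T \<in> \<T>"
  shows "P (\<psi> (ctr T))"
proof (rule ccontr)
  assume neg: "\<not> P (\<psi> (ctr T))"
  have "AE x in lebesgue. x \<in> \<Omega> \<longrightarrow> P (\<psi> x)"
    using AE open_domain by (subst (asm) AE_restrict_space_iff) auto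
  then have "AE x in lebesgue. x \<notin> interior T"
  proof (rule AE_mp, intro AE_I2 impI notI)
    fix x assume "x \<in> \<Omega> \<longrightarrow> P (\<psi> x)" "x \<in> interior T"
    then show False using interior_subset_domain[OF T] const T neg by auto
  qed
  then have "interior T \<in> null_sets lebesgue"
    by (subst AE_iff_null_sets) auto
  then show False
    using open_not_negligible[of "interior T"] centroid_in_interior[OF T] negligible_iff_null_sets by blast
qed

text \<open>Equal coefficients give equal gradients and means inside the elements. Elsewhere both
  operators are 0 by definition, so the integrands agree at every point.\<close>

lemma I_cr_cong:
  assumes "cr_coeffs v G w" "cr_coeffs v' G w"
  shows "I_cr \<Omega> \<T> \<phi> \<psi> v = I_cr \<Omega> \<T> \<phi> \<psi> v'"
proof -
  have "grad_h \<T> v x = grad_h \<T> v' x \<and> proj0 \<T> v x = proj0 \<T> v' x" for x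
  proof (cases "\<exists>T\<in>\<T>. x \<in> interior T")
    case True
    then show ?thesis using grad_h_cr proj0_cr assms by metis
  next
    case False
    then have "indicat_real (interior T) x = 0" if "T \<in> \<T>" for T
      using that by (simp add: indicator_def)
    then show ?thesis by (simp add: grad_h_def proj0_def)
  qed
  then show ?thesis by (simp add: I_cr_def)
qed

lemma D_rt_cong:
  assumes "rt_coeffs y a b" "rt_coeffs y' a b"
  shows "D_rt \<Omega> \<T> \<phi> \<psi> y = D_rt \<Omega> \<T> \<phi> \<psi> y'"
proof -
  have "div_h \<T> y x = div_h \<T> y' x \<and> proj0 \<T> y x = proj0 \<T> y' x" for x
  proof (cases "\<exists>T\<in>\<T>. x \<in> interior T")
    case True
    then show ?thesis using div_h_rt proj0_rt assms by metis
  next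
    case False
    then have "indicat_real (interior T) x = 0" if "T \<in> \<T>" for T
      using that by (simp add: indicator_def)
    then show ?thesis by (simp add: div_h_def proj0_def)
  qed
  then show ?thesis by (simp add: D_rt_def)
qed

text \<open>By integration by parts the duality gap is a sum of nonnegative Fenchel--Young gaps over the
  elements; if it vanishes, so does each of them.\<close>

lemma fenchel_equalities:
  assumes part: "boundary_partition \<Omega> \<Gamma>\<^sub>D \<Gamma>\<^sub>N"
    and \<phi>: "proper_fun \<phi>"
    and const: "\<forall>T\<in>\<T>. \<forall>x\<in>interior T. \<psi> x = \<psi> (ctr T)"
    and \<psi>: "\<forall>T\<in>\<T>. proper_fun (\<psi> (ctr T))"
    and v: "v \<in> CR_D \<Omega> \<Gamma>\<^sub>D \<T>" "cr_coeffs v G w"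
    and y: "y \<in> RT_N \<Omega> \<Gamma>\<^sub>N \<T>" "rt_coeffs y a b"
    and eq: "I_cr \<Omega> \<T> \<phi> \<psi> v = D_rt \<Omega> \<T> \<phi> \<psi> y"
    and T: "T \<in> \<T>"
  shows "\<exists>r t. \<phi> (G T) = ereal r \<and> fenchel_conj \<phi> (a T) = ereal t \<and> r + t = a T \<bullet> G T"
    and "\<exists>r t. \<psi> (ctr T) (w T) = ereal r \<and> fenchel_conj (\<psi> (ctr T)) (real CARD('n) * b T) = ereal t \<and>
            r + t = (real CARD('n) * b T) \<bullet> w T"
proof -
  let ?d = "real CARD('n)"
  let ?A = "\<lambda>T. \<phi> (G T)" and ?B = "\<lambda>T. \<psi> (ctr T) (w T)"
    and ?A' = "\<lambda>T. fenchel_conj \<phi> (a T)" and ?B' = "\<lambda>T. fenchel_conj (\<psi> (ctr T)) (?d * b T)"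
  have nA: "?A T \<noteq> -\<infinity>" for T using \<phi> by (simp add: proper_fun_def)
  have nB: "?B T \<noteq> -\<infinity>" if "T \<in> \<T>" for T using \<psi> that by (simp add: proper_fun_def)
  have nA': "?A' T \<noteq> -\<infinity>" for T by (rule fenchel_conj_not_MInf[OF \<phi>])
  have nB': "?B' T \<noteq> -\<infinity>" if "T \<in> \<T>" for T using \<psi> that by (simp add: fenchel_conj_not_MInf)
  let ?fA = "\<lambda>x. \<phi> (grad_h \<T> v x)" and ?fB = "\<lambda>x. \<psi> x (proj0 \<T> v x)"
    and ?fA' = "\<lambda>x. fenchel_conj \<phi> (proj0 \<T> y x)" and ?fB' = "\<lambda>x. fenchel_conj (\<psi> x) (div_h \<T> y x)"
  have fA: "\<forall>T\<in>\<T>. \<forall>x\<in>interior T. ?fA x = ?A T"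
    and fB: "\<forall>T\<in>\<T>. \<forall>x\<in>interior T. ?fB x = ?B T"
    and fA': "\<forall>T\<in>\<T>. \<forall>x\<in>interior T. ?fA' x = ?A' T"
    and fB': "\<forall>T\<in>\<T>. \<forall>x\<in>interior T. ?fB' x = ?B' T"
    using grad_h_cr[OF v(2)] proj0_cr[OF v(2)] proj0_rt[OF y(2)] div_h_rt[OF y(2)] const by simp_all
  have eA: "ext_integral \<Omega> ?fA \<noteq> -\<infinity>" "ext_integral \<Omega> ?fA \<noteq> \<infinity> \<Longrightarrow> T \<in> \<T> \<Longrightarrow> ?A T \<noteq> \<infinity>"
      "ext_integral \<Omega> ?fA \<noteq> \<infinity> \<Longrightarrow> ext_integral \<Omega> ?fA = ereal (\<Sum>T\<in>\<T>. vol T * real_of_ereal (?A T))" for T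
    using ext_integral_elementwise[OF fA] nA by blast+
  have eB: "ext_integral \<Omega> ?fB \<noteq> -\<infinity>" "ext_integral \<Omega> ?fB \<noteq> \<infinity> \<Longrightarrow> T \<in> \<T> \<Longrightarrow> ?B T \<noteq> \<infinity>"
      "ext_integral \<Omega> ?fB \<noteq> \<infinity> \<Longrightarrow> ext_integral \<Omega> ?fB = ereal (\<Sum>T\<in>\<T>. vol T * real_of_ereal (?B T))" for T
    using ext_integral_elementwise[OF fB] nB by blast+
  have eA': "ext_integral \<Omega> ?fA' \<noteq> -\<infinity>" "ext_integral \<Omega> ?fA' \<noteq> \<infinity> \<Longrightarrow> T \<in> \<T> \<Longrightarrow> ?A' T \<noteq> \<infinity>"
      "ext_integral \<Omega> ?fA' \<noteq> \<infinity> \<Longrightarrow> ext_integral \<Omega> ?fA' = ereal (\<Sum>T\<in>\<T>. vol T * real_of_ereal (?A' T))" for T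
    using ext_integral_elementwise[OF fA'] nA' by blast+
  have eB': "ext_integral \<Omega> ?fB' \<noteq> -\<infinity>" "ext_integral \<Omega> ?fB' \<noteq> \<infinity> \<Longrightarrow> T \<in> \<T> \<Longrightarrow> ?B' T \<noteq> \<infinity>"
      "ext_integral \<Omega> ?fB' \<noteq> \<infinity> \<Longrightarrow> ext_integral \<Omega> ?fB' = ereal (\<Sum>T\<in>\<T>. vol T * real_of_ereal (?B' T))" for T
    using ext_integral_elementwise[OF fB'] nB' by blast+
  have "ext_integral \<Omega> ?fA + ext_integral \<Omega> ?fB = - ext_integral \<Omega> ?fA' - ext_integral \<Omega> ?fB'"
    using eq unfolding I_cr_def D_rt_def .
  \<comment> \<open>None of the four integrals is -\<infinity>, so the primal value is not
    -\<infinity> and the dual value is not \<infinity>. Being equal, both are finite, and so is each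
    integral.\<close>
  then have fin: "ext_integral \<Omega> ?fA \<noteq> \<infinity>" "ext_integral \<Omega> ?fB \<noteq> \<infinity>"
      "ext_integral \<Omega> ?fA' \<noteq> \<infinity>" "ext_integral \<Omega> ?fB' \<noteq> \<infinity>"
    and sum0: "ext_integral \<Omega> ?fA + ext_integral \<Omega> ?fB + ext_integral \<Omega> ?fA' + ext_integral \<Omega> ?fB' = 0"
    using eA(1) eB(1) eA'(1) eB'(1)
    by (cases "ext_integral \<Omega> ?fA"; cases "ext_integral \<Omega> ?fB"; cases "ext_integral \<Omega> ?fA'";
        cases "ext_integral \<Omega> ?fB'"; simp)+
  let ?R = real_of_ereal
  have A: "?A T = ereal (?R (?A T))" if "T \<in> \<T>" for T
    using nA[of T] eA(2)[OF fin(1) that] by (cases "?A T") auto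
  have B: "?B T = ereal (?R (?B T))" if "T \<in> \<T>" for T
    using nB[OF that] eB(2)[OF fin(2) that] by (cases "?B T") auto
  have A': "?A' T = ereal (?R (?A' T))" if "T \<in> \<T>" for T
    using nA'[of T] eA'(2)[OF fin(3) that] by (cases "?A' T") auto
  have B': "?B' T = ereal (?R (?B' T))" if "T \<in> \<T>" for T
    using nB'[OF that] eB'(2)[OF fin(4) that] by (cases "?B' T") auto
  define gA where "gA T = ?R (?A T) + ?R (?A' T) - a T \<bullet> G T" for T
  define gB where "gB T = ?R (?B T) + ?R (?B' T) - (?d * b T) \<bullet> w T" for T
  have gA: "gA T \<ge> 0" if "T \<in> \<T>" for T
  proof -
    have "ereal (a T \<bullet> G T) \<le> ?A T + ?A' T" by (rule fenchel_young[OF nA nA'])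
    then have "ereal (a T \<bullet> G T) \<le> ereal (?R (?A T)) + ereal (?R (?A' T))"
      using A[OF that] A'[OF that] by metis
    then show ?thesis by (simp add: gA_def)
  qed
  have gB: "gB T \<ge> 0" if "T \<in> \<T>" for T
  proof -
    have "ereal ((?d * b T) \<bullet> w T) \<le> ?B T + ?B' T" by (rule fenchel_young[OF nB[OF that] nB'[OF that]])
    then have "ereal ((?d * b T) \<bullet> w T) \<le> ereal (?R (?B T)) + ereal (?R (?B' T))"
      using B[OF that] B'[OF that] by metis
    then show ?thesis by (simp add: gB_def)
  qed
  have "(\<Sum>T\<in>\<T>. vol T * ?R (?A T)) + (\<Sum>T\<in>\<T>. vol T * ?R (?B T)) + (\<Sum>T\<in>\<T>. vol T * ?R (?A' T)) + (\<Sum>T\<in>\<T>. vol T * ?R (?B' T)) = 0"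
    using sum0 unfolding eA(3)[OF fin(1)] eB(3)[OF fin(2)] eA'(3)[OF fin(3)] eB'(3)[OF fin(4)] by simp
  moreover have "(\<Sum>T\<in>\<T>. vol T * (G T \<bullet> a T + w T * (?d * b T))) = 0"
    by (rule integration_by_parts[OF part v y])
  ultimately have "(\<Sum>T\<in>\<T>. vol T * ?R (?A T)) + (\<Sum>T\<in>\<T>. vol T * ?R (?B T)) + (\<Sum>T\<in>\<T>. vol T * ?R (?A' T)) + (\<Sum>T\<in>\<T>. vol T * ?R (?B' T))
      - (\<Sum>T\<in>\<T>. vol T * (G T \<bullet> a T + w T * (?d * b T))) = 0" by simp
  then have "(\<Sum>T\<in>\<T>. vol T * ?R (?A T) + vol T * ?R (?B T) + vol T * ?R (?A' T) + vol T * ?R (?B' T) - vol T * (G T \<bullet> a T + w T * (?d * b T))) = 0"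
    by (simp only: sum.distrib sum_subtractf)
  then have "(\<Sum>T\<in>\<T>. vol T * (gA T + gB T)) = 0"
    unfolding gA_def gB_def by (simp only: inner_commute[of "G _"] inner_real_def algebra_simps)
  moreover have "\<And>T. T \<in> \<T> \<Longrightarrow> 0 \<le> vol T * (gA T + gB T)"
    using gA gB by simp
  ultimately have "vol T * (gA T + gB T) = 0"
    using sum_nonneg_eq_0_iff[OF finite_mesh, of "\<lambda>T. vol T * (gA T + gB T)"] T by blast
  then have "gA T = 0" "gB T = 0"
    using vol_pos[OF T] gA[OF T] gB[OF T] by (auto simp: add_nonneg_eq_0_iff)
  then show "\<exists>r t. \<phi> (G T) = ereal r \<and> fenchel_conj \<phi> (a T) = ereal t \<and> r + t = a T \<bullet> G T"
    and "\<exists>r t. \<psi> (ctr T) (w T) = ereal r \<and> fenchel_conj (\<psi> (ctr T)) (?d * b T) = ereal t \<and>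
            r + t = (?d * b T) \<bullet> w T"
    using A[OF T] A'[OF T] B[OF T] B'[OF T] unfolding gA_def gB_def
    by (metis eq_iff_diff_eq_0)+
qed

end

section \<open>From equalities on the elements to the formulas\<close>

lemma is_arg_min_INF:
  fixes f :: "'a \<Rightarrow> 'b::complete_linorder"
  assumes "is_arg_min f (\<lambda>v. v \<in> S) u"
  shows "(INF v\<in>S. f v) = f u"
  using assms by (auto simp: is_arg_min_def not_less intro!: antisym INF_lower INF_greatest)

lemma is_arg_max_SUP:
  fixes f :: "'a \<Rightarrow> 'b::complete_linorder"
  assumes "is_arg_max f (\<lambda>v. v \<in> S) u"
  shows "(SUP v\<in>S. f v) = f u"
  using assms by (auto simp: is_arg_max_def not_less intro!: antisym SUP_upper SUP_least)

theorem proposition3p5: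
  fixes \<Omega> \<Gamma>\<^sub>D \<Gamma>\<^sub>N :: "(real^'n) set"
    and \<F> :: "(real^'n) set set set"
    and \<T> :: "(real^'n) set set"
    and \<phi> :: "real^'n \<Rightarrow> ereal"
    and \<psi> :: "real^'n \<Rightarrow> real \<Rightarrow> ereal"
  assumes "polyhedral_Lipschitz_domain \<Omega>"
    and "boundary_partition \<Omega> \<Gamma>\<^sub>D \<Gamma>\<^sub>N"
    and "\<And>\<T>'. \<T>' \<in> \<F> \<Longrightarrow> conforming_triangulation \<Omega> \<T>'"
    and "uniformly_shape_regular \<F>"
    and "\<T> \<in> \<F>"
    and "boundary_fitted \<Omega> \<Gamma>\<^sub>D \<Gamma>\<^sub>N \<T>"
    and "proper_fun \<phi>" and "convex_fun \<phi>" and "lsc_fun \<phi>"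
    and "\<And>x t. x \<in> \<Omega> \<Longrightarrow> \<psi> x t \<noteq> -\<infinity>"
    and "\<And>t. elementwise_const \<T> (\<lambda>x. \<psi> x t)"
    and "AE x in lebesgue_on \<Omega>. proper_fun (\<psi> x) \<and> convex_fun (\<psi> x) \<and> lsc_fun (\<psi> x)"
    and "\<exists>u. is_arg_min (I_cr \<Omega> \<T> \<phi> \<psi>) (\<lambda>v. v \<in> CR_D \<Omega> \<Gamma>\<^sub>D \<T>) u"
    and "\<exists>z. is_arg_max (D_rt \<Omega> \<T> \<phi> \<psi>) (\<lambda>y. y \<in> RT_N \<Omega> \<Gamma>\<^sub>N \<T>) z"
    and "(INF v\<in>CR_D \<Omega> \<Gamma>\<^sub>D \<T>. I_cr \<Omega> \<T> \<phi> \<psi> v) = (SUP y\<in>RT_N \<Omega> \<Gamma>\<^sub>N \<T>. D_rt \<Omega> \<T> \<phi> \<psi> y)"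
  shows "(C1_ext \<phi> \<and> (AE x in lebesgue_on \<Omega>. C1_ext (\<psi> x)) \<longrightarrow>
           (\<forall>u. is_arg_min (I_cr \<Omega> \<T> \<phi> \<psi>) (\<lambda>v. v \<in> CR_D \<Omega> \<Gamma>\<^sub>D \<T>) u \<longrightarrow>
              (let z = (\<lambda>x. D_ext \<phi> (grad_h \<T> u x) +
                            (D_ext (\<psi> x) (proj0 \<T> u x) / real CARD('n)) *\<^sub>R (x - proj0 \<T> (\<lambda>y. y) x))
               in z \<in> RT_N \<Omega> \<Gamma>\<^sub>N \<T> \<and>
                  is_arg_max (D_rt \<Omega> \<T> \<phi> \<psi>) (\<lambda>y. y \<in> RT_N \<Omega> \<Gamma>\<^sub>N \<T>) z \<and>
                  I_cr \<Omega> \<T> \<phi> \<psi> u = D_rt \<Omega> \<T> \<phi> \<psi> z)))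
       \<and> (C1_ext (fenchel_conj \<phi>) \<and> (AE x in lebesgue_on \<Omega>. C1_ext (fenchel_conj (\<psi> x))) \<longrightarrow>
           (\<forall>z. is_arg_max (D_rt \<Omega> \<T> \<phi> \<psi>) (\<lambda>y. y \<in> RT_N \<Omega> \<Gamma>\<^sub>N \<T>) z \<longrightarrow>
              (let u = (\<lambda>x. D_ext (fenchel_conj (\<psi> x)) (div_h \<T> z x) +
                            D_ext (fenchel_conj \<phi>) (proj0 \<T> z x) \<bullet> (x - proj0 \<T> (\<lambda>y. y) x))
               in u \<in> CR_D \<Omega> \<Gamma>\<^sub>D \<T> \<and>
                  is_arg_min (I_cr \<Omega> \<T> \<phi> \<psi>) (\<lambda>v. v \<in> CR_D \<Omega> \<Gamma>\<^sub>D \<T>) u \<and>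
                  I_cr \<Omega> \<T> \<phi> \<psi> u = D_rt \<Omega> \<T> \<phi> \<psi> z)))"
proof -
  interpret mesh \<Omega> \<T>
    using assms(1,3,5) by unfold_locales (auto simp: polyhedral_Lipschitz_domain_def)
  let ?I = "I_cr \<Omega> \<T> \<phi> \<psi>" and ?D = "D_rt \<Omega> \<T> \<phi> \<psi>"
  obtain u0 z0 where u0: "is_arg_min ?I (\<lambda>v. v \<in> CR_D \<Omega> \<Gamma>\<^sub>D \<T>) u0"
    and z0: "is_arg_max ?D (\<lambda>y. y \<in> RT_N \<Omega> \<Gamma>\<^sub>N \<T>) z0"
    using assms(13,14) by blast
  \<comment> \<open>Constancy on an element is given for each argument \<open>t\<close> separately;
    extensionality turns it into constancy of the function \<open>\<psi> x\<close>.\<close>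
  have const: "\<forall>T\<in>\<T>. \<forall>x\<in>interior T. \<psi> x = \<psi> (ctr T)"
    using assms(11) centroid_in_interior unfolding elementwise_const_def by (metis ext)
  have proper: "\<forall>T\<in>\<T>. proper_fun (\<psi> (ctr T))"
  proof -
    have "AE x in lebesgue_on \<Omega>. proper_fun (\<psi> x)" using assms(12) by (rule AE_mp) auto
    then show ?thesis using AE_elementwise[OF _ const] by blast
  qed
  \<comment> \<open>Stated for every pair of optimizers: it serves the one whose existence is
    assumed and then the one given by the formula.\<close>
  have duality: "?I u = ?D z"
    if "is_arg_min ?I (\<lambda>v. v \<in> CR_D \<Omega> \<Gamma>\<^sub>D \<T>) u" "is_arg_max ?D (\<lambda>y. y \<in> RT_N \<Omega> \<Gamma>\<^sub>N \<T>) z" for u z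
    using assms(15) is_arg_min_INF[OF that(1)] is_arg_max_SUP[OF that(2)] by simp
  have cr: "\<exists>G w. cr_coeffs u G w" if "u \<in> CR_D \<Omega> \<Gamma>\<^sub>D \<T>" for u
  proof -
    have "u \<in> L_space 1 \<T>" using that by (simp add: CR_D_def CR_def)
    then show ?thesis using cr_coeffs_exist by blast
  qed
  have rt: "\<exists>a b. rt_coeffs z a b" if "z \<in> RT_N \<Omega> \<Gamma>\<^sub>N \<T>" for z
  proof -
    have "z \<in> RT \<Omega> \<T>" using that by (simp add: RT_N_def)
    then show ?thesis using rt_coeffs_exist by blast
  qed
  show ?thesis
  proof (intro conjI impI allI)
    fix u
    assume C1: "C1_ext \<phi> \<and> (AE x in lebesgue_on \<Omega>. C1_ext (\<psi> x))"
      and u: "is_arg_min ?I (\<lambda>v. v \<in> CR_D \<Omega> \<Gamma>\<^sub>D \<T>) u"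
    define z where "z = (\<lambda>x. D_ext \<phi> (grad_h \<T> u x) +
      (D_ext (\<psi> x) (proj0 \<T> u x) / real CARD('n)) *\<^sub>R (x - proj0 \<T> (\<lambda>y. y) x))"
    have uS: "u \<in> CR_D \<Omega> \<Gamma>\<^sub>D \<T>" and zS: "z0 \<in> RT_N \<Omega> \<Gamma>\<^sub>N \<T>"
      using u z0 by (simp_all add: is_arg_min_def is_arg_max_def)
    obtain G w a b where co: "cr_coeffs u G w" "rt_coeffs z0 a b"
      using cr[OF uS] rt[OF zS] by blast
    note fe = fenchel_equalities[OF assms(2,7) const proper uS co(1) zS co(2) duality[OF u z0]]
    have eq: "z0 x = z x" if T: "T \<in> \<T>" and x: "x \<in> interior T" for T x
    proof -
      have "C1_ext (\<psi> (ctr T))"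
        by (rule AE_elementwise[OF conjunct2[OF C1] const T])
      then have "D_ext \<phi> (G T) = a T" "D_ext (\<psi> (ctr T)) (w T) = real CARD('n) * b T"
        using fe(1)[OF T] fe(2)[OF T] C1 C1_ext_equality by blast+
      then show ?thesis
        using co T x by (simp add: z_def rt_coeffs_def const grad_h_cr[OF co(1) T x] proj0_cr[OF co(1) T x] proj0_id[OF T x])
    qed
    have mem: "z \<in> RT_N \<Omega> \<Gamma>\<^sub>N \<T>"
      by (rule RT_N_cong[OF eq zS])
    have "rt_coeffs z a b"
      using co(2) eq by (simp add: rt_coeffs_def)
    then have Dz: "?D z = ?D z0"
      using D_rt_cong co(2) by blast
    have "is_arg_max ?D (\<lambda>y. y \<in> RT_N \<Omega> \<Gamma>\<^sub>N \<T>) z"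
      using z0 mem by (simp add: is_arg_max_def Dz)
    then show "let z = (\<lambda>x. D_ext \<phi> (grad_h \<T> u x) +
                            (D_ext (\<psi> x) (proj0 \<T> u x) / real CARD('n)) *\<^sub>R (x - proj0 \<T> (\<lambda>y. y) x))
               in z \<in> RT_N \<Omega> \<Gamma>\<^sub>N \<T> \<and> is_arg_max ?D (\<lambda>y. y \<in> RT_N \<Omega> \<Gamma>\<^sub>N \<T>) z \<and> ?I u = ?D z"
      unfolding z_def[symmetric] Let_def using mem duality[OF u] by blast
  next
    fix z
    assume C1: "C1_ext (fenchel_conj \<phi>) \<and> (AE x in lebesgue_on \<Omega>. C1_ext (fenchel_conj (\<psi> x)))"
      and z: "is_arg_max ?D (\<lambda>y. y \<in> RT_N \<Omega> \<Gamma>\<^sub>N \<T>) z"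
    define u where "u = (\<lambda>x. D_ext (fenchel_conj (\<psi> x)) (div_h \<T> z x) +
      D_ext (fenchel_conj \<phi>) (proj0 \<T> z x) \<bullet> (x - proj0 \<T> (\<lambda>y. y) x))"
    have uS: "u0 \<in> CR_D \<Omega> \<Gamma>\<^sub>D \<T>" and zS: "z \<in> RT_N \<Omega> \<Gamma>\<^sub>N \<T>"
      using u0 z by (simp_all add: is_arg_min_def is_arg_max_def)
    obtain G w a b where co: "cr_coeffs u0 G w" "rt_coeffs z a b"
      using cr[OF uS] rt[OF zS] by blast
    note fe = fenchel_equalities[OF assms(2,7) const proper uS co(1) zS co(2) duality[OF u0 z]]
    have eq: "u0 x = u x" if T: "T \<in> \<T>" and x: "x \<in> interior T" for T x
    proof -
      have "C1_ext (fenchel_conj (\<psi> (ctr T)))"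
        by (rule AE_elementwise[OF conjunct2[OF C1] const T])
      then have "D_ext (fenchel_conj \<phi>) (a T) = G T" "D_ext (fenchel_conj (\<psi> (ctr T))) (real CARD('n) * b T) = w T"
        using fe(1)[OF T] fe(2)[OF T] C1 C1_ext_conj_equality by blast+
      then show ?thesis
        using co T x by (simp add: u_def cr_coeffs_def const div_h_rt[OF co(2) T x] proj0_rt[OF co(2) T x] proj0_id[OF T x])
    qed
    have mem: "u \<in> CR_D \<Omega> \<Gamma>\<^sub>D \<T>"
      by (rule CR_D_cong[OF eq uS])
    have "cr_coeffs u G w"
      using co(1) eq by (simp add: cr_coeffs_def)
    then have Iu: "?I u = ?I u0"
      using I_cr_cong co(1) by blast
    have "is_arg_min ?I (\<lambda>v. v \<in> CR_D \<Omega> \<Gamma>\<^sub>D \<T>) u"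
      using u0 mem by (simp add: is_arg_min_def Iu)
    then show "let u = (\<lambda>x. D_ext (fenchel_conj (\<psi> x)) (div_h \<T> z x) +
                            D_ext (fenchel_conj \<phi>) (proj0 \<T> z x) \<bullet> (x - proj0 \<T> (\<lambda>y. y) x))
               in u \<in> CR_D \<Omega> \<Gamma>\<^sub>D \<T> \<and> is_arg_min ?I (\<lambda>v. v \<in> CR_D \<Omega> \<Gamma>\<^sub>D \<T>) u \<and> ?I u = ?D z"
      unfolding u_def[symmetric] Let_def using mem duality[OF _ z] by blast
  qed
qed

end
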